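(* Let $m\ge 2$ be an integer. The ring homomorphism $\Phi_m' \to (\Phi_m)_\rho$ defined by $x_I \mapsto x_I$ for $I\in\mathcal I_m$ is an isomorphism, where $$\Phi'_m := \big(\mathbb Z[x_I \mid I \in \mathcal I_m]/\langle \phi_{123}, \phi_{124},\dotsc, \phi_{12m} \rangle\big)_\rho ,$$ $\phi_{12i} := \phi(x_1, x_2, x_i, x_{12}, x_{1i}, x_{2i}, x_{12i})$ for $3 \leq i \leq m$, $\rho := x_1^2+x_2^2+x_{12}^2-x_1x_2x_{12}-4$, and $\Phi_m$ is the ring of Fricke characters.
   Context: For a ring $R$ and $r\in R$, $R_r$ denotes the localisation of $R$ at $\{1,r,r^2,\dots\}$. Index set: $\mathcal I_m := \{\{i\} \mid 1 \leq i \leq m\} \cup \{\{i,j\} \mid 1\leq i \leq 2,\ i < j \leq m\} \cup \{\{1,2,k\} \mid 3 \leq k \leq m\}$. Subscripts abbreviate sets: $x_i=x_{\{i\}}$, $x_{ij}=x_{\{i,j\}}$, $x_{12i}=x_{\{1,2,i\}}$. Fricke polynomial: $$\phi(x_1,x_2,x_3,x_{12}, x_{13}, x_{23}, x_{123}) := x_{123}^2 + (x_1x_2x_3 - x_1x_{23} - x_2x_{13} - x_3x_{12})x_{123} + x_1^2 + x_2^2 + x_3^2 + x_{12}^2 + x_{13}^2 + x_{23}^2 - x_1x_2x_{12} - x_1x_3x_{13} - x_2x_3x_{23} + x_{12}x_{13}x_{23} - 4.$$ Ring of Fricke characters: let $X_m=\{x_I \mid \emptyset\ne I\subseteq\{1,\dots,m\}\}$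 be a set of indeterminates over $\mathbb Z$. For $A=(A_1,\dots,A_m)\in \mathrm{SL}(2,K)^m$ ($K$ a field) let $\varepsilon_A:\mathbb Z[X_m]\to K$ be the ring homomorphism sending $x_I$ to $\mathrm{tr}(A_{i_1}\cdots A_{i_k})$ for $I=\{i_1<\dots<i_k\}$. Let $I_m:=\{f\in\mathbb Z[X_m] \mid \varepsilon_A(f)=0 \text{ for all } A\in\mathrm{SL}(2,\mathbb C)^m\}$ and $\Phi_m:=\mathbb Z[X_m]/I_m$. *)

theory Defs
  imports
    "HOL-Analysis.Determinants"
    "HOL-Library.Poly_Mapping"
    "HOL-Algebra.QuotRing"
begin

text \<open>A monomial is a finitely supported exponent function; the product on the outer
  \<^type>\<open>poly_mapping\<close> is convolution, i.e. multiplication of polynomials.\<close>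

type_synonym 'v zpoly = "('v \<Rightarrow>\<^sub>0 nat) \<Rightarrow>\<^sub>0 int"

definition Var :: "'v \<Rightarrow> 'v zpoly" where
  "Var v = Poly_Mapping.single (Poly_Mapping.single v 1) 1"

definition zpoly_vars :: "'v zpoly \<Rightarrow> 'v set" where
  "zpoly_vars p = (\<Union>mon \<in> Poly_Mapping.keys p. Poly_Mapping.keys mon)"

definition zpoly_eval :: "('v \<Rightarrow> 'a::comm_ring_1) \<Rightarrow> 'v zpoly \<Rightarrow> 'a" where
  "zpoly_eval f p = (\<Sum>mon \<in> Poly_Mapping.keys p.
     of_int (Poly_Mapping.lookup p mon) *
     (\<Prod>v \<in> Poly_Mapping.keys mon. f v ^ Poly_Mapping.lookup mon v))"

definition zpoly_ring :: "'v set \<Rightarrow> 'v zpoly ring" where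
  "zpoly_ring V = \<lparr> carrier = {p. zpoly_vars p \<subseteq> V}, monoid.mult = (*), one = 1,
                    ring.zero = 0, add = (+) \<rparr>"

text \<open>Here \<open>S\<close> is meant to be a multiplicative submonoid of \<open>R\<close>. The fraction \<open>a/s\<close> is the class
  of \<open>(a, s)\<close> under: \<open>(a, s) ~ (b, t)\<close> iff \<open>u (t a - s b) = 0\<close> for some \<open>u \<in> S\<close>. The factor \<open>u\<close>
  is needed because \<open>R\<close> may have zero divisors.\<close>

definition fraction :: "('a, 'c) ring_scheme \<Rightarrow> 'a set \<Rightarrow> 'a \<Rightarrow> 'a \<Rightarrow> ('a \<times> 'a) set" where
  "fraction R S a s = {(b, t). b \<in> carrier R \<and> t \<in> S \<and>
     (\<exists>u \<in> S. u \<otimes>\<^bsub>R\<^esub> ((t \<otimes>\<^bsub>R\<^esub> a) \<ominus>\<^bsub>R\<^esub> (s \<otimes>\<^bsub>R\<^esub> b)) = \<zero>\<^bsub>R\<^esub>)}"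

text \<open>The operations on classes take the union over all choices of representatives; by
  well-definedness all members of these unions coincide.\<close>

definition localisation :: "('a, 'c) ring_scheme \<Rightarrow> 'a set \<Rightarrow> ('a \<times> 'a) set ring" where
  "localisation R S = \<lparr>
     carrier = {fraction R S a s | a s. a \<in> carrier R \<and> s \<in> S},
     monoid.mult = (\<lambda>X Y. \<Union>(a, s) \<in> X. \<Union>(b, t) \<in> Y. fraction R S (a \<otimes>\<^bsub>R\<^esub> b) (s \<otimes>\<^bsub>R\<^esub> t)),
     one = fraction R S \<one>\<^bsub>R\<^esub> \<one>\<^bsub>R\<^esub>,
     ring.zero = fraction R S \<zero>\<^bsub>R\<^esub> \<one>\<^bsub>R\<^esub>,
     add = (\<lambda>X Y. \<Union>(a, s) \<in> X. \<Union>(b, t) \<in> Y.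
              fraction R S ((t \<otimes>\<^bsub>R\<^esub> a) \<oplus>\<^bsub>R\<^esub> (s \<otimes>\<^bsub>R\<^esub> b)) (s \<otimes>\<^bsub>R\<^esub> t)) \<rparr>"

definition powers_of :: "('a, 'c) ring_scheme \<Rightarrow> 'a \<Rightarrow> 'a set" where
  "powers_of R r = {r [^]\<^bsub>R\<^esub> n | n :: nat. True}"

definition localisation_at :: "('a, 'c) ring_scheme \<Rightarrow> 'a \<Rightarrow> ('a \<times> 'a) set ring" where
  "localisation_at R r = localisation R (powers_of R r)"

definition to_localisation_at :: "('a, 'c) ring_scheme \<Rightarrow> 'a \<Rightarrow> 'a \<Rightarrow> ('a \<times> 'a) set" where
  "to_localisation_at R r a = fraction R (powers_of R r) a \<one>\<^bsub>R\<^esub>"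

text \<open>The indeterminate \<open>x\<^sub>I\<close> is \<^term>\<open>Var I\<close> with \<open>I\<close> a set of natural numbers.\<close>

definition Fricke_index :: "nat \<Rightarrow> nat set set" where
  "Fricke_index m = {I. I \<noteq> {} \<and> I \<subseteq> {1..m}}"

definition SL2 :: "('a::field ^ 2 ^ 2) set" where
  "SL2 = {A. det A = 1}"

definition trace_word :: "(nat \<Rightarrow> 'a::field ^ 2 ^ 2) \<Rightarrow> nat set \<Rightarrow> 'a" where
  "trace_word A I = trace (foldr (\<lambda>i B. A i ** B) (sorted_list_of_set I) (mat 1))"

definition Fricke_eval :: "(nat \<Rightarrow> 'a::field ^ 2 ^ 2) \<Rightarrow> nat set zpoly \<Rightarrow> 'a" where
  "Fricke_eval A f = zpoly_eval (trace_word A) f"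

definition Fricke_ideal :: "nat \<Rightarrow> nat set zpoly set" where
  "Fricke_ideal m = {f \<in> carrier (zpoly_ring (Fricke_index m)).
     \<forall>A :: nat \<Rightarrow> complex ^ 2 ^ 2. A \<in> ({1..m} \<rightarrow>\<^sub>E SL2) \<longrightarrow> Fricke_eval A f = 0}"

definition Fricke_ring :: "nat \<Rightarrow> nat set zpoly set ring" where
  "Fricke_ring m = zpoly_ring (Fricke_index m) Quot Fricke_ideal m"

definition Fricke_class :: "nat \<Rightarrow> nat set zpoly \<Rightarrow> nat set zpoly set" where
  "Fricke_class m f = Fricke_ideal m +>\<^bsub>zpoly_ring (Fricke_index m)\<^esub> f"

definition small_index :: "nat \<Rightarrow> nat set set" where
  "small_index m =
     {{i} | i. 1 \<le> i \<and> i \<le> m} \<union>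
     {{i, j} | i j. 1 \<le> i \<and> i \<le> 2 \<and> i < j \<and> j \<le> m} \<union>
     {{1, 2, k} | k. 3 \<le> k \<and> k \<le> m}"

definition Fricke_phi :: "'a::comm_ring_1 \<Rightarrow> 'a \<Rightarrow> 'a \<Rightarrow> 'a \<Rightarrow> 'a \<Rightarrow> 'a \<Rightarrow> 'a \<Rightarrow> 'a" where
  "Fricke_phi x1 x2 x3 x12 x13 x23 x123 =
     x123^2 + (x1*x2*x3 - x1*x23 - x2*x13 - x3*x12) * x123
     + x1^2 + x2^2 + x3^2 + x12^2 + x13^2 + x23^2
     - x1*x2*x12 - x1*x3*x13 - x2*x3*x23 + x12*x13*x23 - 4"

definition phi12 :: "nat \<Rightarrow> nat set zpoly" where
  "phi12 i = Fricke_phi (Var {1}) (Var {2}) (Var {i})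
                        (Var {1,2}) (Var {1,i}) (Var {2,i}) (Var {1,2,i})"

definition rho :: "nat set zpoly" where
  "rho = (Var {1})^2 + (Var {2})^2 + (Var {1,2})^2 - Var {1} * Var {2} * Var {1,2} - 4"

definition phi_ideal :: "nat \<Rightarrow> nat set zpoly set" where
  "phi_ideal m = Idl\<^bsub>zpoly_ring (small_index m)\<^esub> (phi12 ` {3..m})"

definition phi_quotient :: "nat \<Rightarrow> nat set zpoly set ring" where
  "phi_quotient m = zpoly_ring (small_index m) Quot phi_ideal m"

definition phi_class :: "nat \<Rightarrow> nat set zpoly \<Rightarrow> nat set zpoly set" where
  "phi_class m f = phi_ideal m +>\<^bsub>zpoly_ring (small_index m)\<^esub> f"

text \<open>\<open>\<Phi>'\<^sub>m\<close> and \<open>(\<Phi>\<^sub>m)\<^sub>\<rho>\<close>, together with the elements \<open>x\<^sub>I\<close> of each.\<close>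

definition Phi' :: "nat \<Rightarrow> (nat set zpoly set \<times> nat set zpoly set) set ring" where
  "Phi' m = localisation_at (phi_quotient m) (phi_class m rho)"

definition x_Phi' :: "nat \<Rightarrow> nat set \<Rightarrow> (nat set zpoly set \<times> nat set zpoly set) set" where
  "x_Phi' m I = to_localisation_at (phi_quotient m) (phi_class m rho) (phi_class m (Var I))"

definition Phi_rho :: "nat \<Rightarrow> (nat set zpoly set \<times> nat set zpoly set) set ring" where
  "Phi_rho m = localisation_at (Fricke_ring m) (Fricke_class m rho)"

definition x_Phi_rho :: "nat \<Rightarrow> nat set \<Rightarrow> (nat set zpoly set \<times> nat set zpoly set) set" where
  "x_Phi_rho m I = to_localisation_at (Fricke_ring m) (Fricke_class m rho) (Fricke_class m (Var I))"

end

theory Submission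
  imports
    Defs
    "HOL-Computational_Algebra.Polynomial"
    "HOL-Algebra.Multiplicative_Group"
begin

text \<open>Let \<open>A, B \<in> SL\<^sub>2(\<complex>)\<close> have traces \<open>x\<^sub>1, x\<^sub>2\<close> and \<open>tr AB = x\<^sub>1\<^sub>2\<close>. The trace form has Gram determinant
  \<open>- \<rho>\<^sup>2\<close> on \<open>1, A, B, AB\<close>, so where \<open>\<rho> \<noteq> 0\<close> these four matrices form a basis, and for every matrix \<open>C\<close>
  the coordinates of \<open>\<rho> C\<close> are integral polynomials in \<open>x\<^sub>1, x\<^sub>2, x\<^sub>1\<^sub>2\<close> and
  \<open>tr C, tr AC, tr BC, tr ABC\<close>. Expanding a word \<open>A\<^sub>i\<^sub>1 \<dots> A\<^sub>i\<^sub>k\<close> letter by letter in this basis shows that a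
  power of \<open>\<rho>\<close> times any \<open>x\<^sub>I\<close> is a polynomial in the small generators: this is surjectivity.

  For injectivity, conversely, any four numbers are the traces \<open>tr C, tr AC, tr BC, tr ABC\<close> of some \<open>C\<close>,
  and \<open>\<phi> = \<rho> (1 - det C)\<close>, so every complex point with \<open>\<rho> \<noteq> 0\<close> and all \<open>\<phi>\<^sub>1\<^sub>2\<^sub>i = 0\<close> comes from a tuple in
  \<open>SL\<^sub>2(\<complex>)\<close>. A polynomial vanishing at all these points lies in \<open>\<langle>\<phi>\<^sub>1\<^sub>2\<^sub>3, \<dots>, \<phi>\<^sub>1\<^sub>2\<^sub>m\<rangle>\<close>, because each
  \<open>\<phi>\<^sub>1\<^sub>2\<^sub>i\<close> is monic quadratic in \<open>x\<^sub>1\<^sub>2\<^sub>i\<close>, with two distinct roots at generic points. So the map is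
  injective even before localising.\<close>

section \<open>Integral polynomials\<close>

definition monom_value :: "('v \<Rightarrow> 'a::comm_ring_1) \<Rightarrow> ('v \<Rightarrow>\<^sub>0 nat) \<Rightarrow> 'a" where
  "monom_value f mn = (\<Prod>v \<in> Poly_Mapping.keys mn. f v ^ Poly_Mapping.lookup mn v)"

lemma monom_value_superset:
  assumes "finite K" "Poly_Mapping.keys mn \<subseteq> K"
  shows "monom_value f mn = (\<Prod>v \<in> K. f v ^ Poly_Mapping.lookup mn v)"
  unfolding monom_value_def using assms
  by (intro prod.mono_neutral_left) (auto simp: in_keys_iff)

lemma monom_value_zero [simp]: "monom_value f 0 = 1"
  by (simp add: monom_value_def)

lemma monom_value_single [simp]: "monom_value f (Poly_Mapping.single v n) = f v ^ n"
  by (simp add: monom_value_def)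

lemma monom_value_add: "monom_value f (m + n) = monom_value f m * monom_value f n"
proof -
  let ?K = "Poly_Mapping.keys m \<union> Poly_Mapping.keys n"
  have "monom_value f (m + n) = (\<Prod>v \<in> ?K. f v ^ Poly_Mapping.lookup (m + n) v)"
    by (rule monom_value_superset) (use Poly_Mapping.keys_add[of m n] in auto)
  also have "\<dots> = (\<Prod>v \<in> ?K. f v ^ Poly_Mapping.lookup m v) * (\<Prod>v \<in> ?K. f v ^ Poly_Mapping.lookup n v)"
    by (simp add: lookup_add power_add prod.distrib)
  also have "\<dots> = monom_value f m * monom_value f n"
    using monom_value_superset[of ?K m f] monom_value_superset[of ?K n f] by simp
  finally show ?thesis .
qed

lemma zpoly_eval_superset:
  assumes "finite K" "Poly_Mapping.keys p \<subseteq> K"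
  shows "zpoly_eval f p = (\<Sum>mn \<in> K. of_int (Poly_Mapping.lookup p mn) * monom_value f mn)"
  unfolding zpoly_eval_def monom_value_def[symmetric] using assms
  by (intro sum.mono_neutral_left) (auto simp: in_keys_iff)

lemma zpoly_eval_single [simp]:
  "zpoly_eval f (Poly_Mapping.single m c) = of_int c * monom_value f m"
  by (subst zpoly_eval_superset[of "{m}"]) auto

lemma zpoly_eval_add [simp]: "zpoly_eval f (p + q) = zpoly_eval f p + zpoly_eval f q"
proof -
  let ?K = "Poly_Mapping.keys p \<union> Poly_Mapping.keys q"
  have "Poly_Mapping.keys (p + q) \<subseteq> ?K" by (rule Poly_Mapping.keys_add)
  then show ?thesis
    by (simp add: zpoly_eval_superset[of ?K] lookup_add distrib_right sum.distrib)
qed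

lemma poly_mapping_sum_single:
  "(\<Sum>k \<in> Poly_Mapping.keys p. Poly_Mapping.single k (Poly_Mapping.lookup p k)) = p"
  by (rule poly_mapping_eqI)
     (auto simp: lookup_sum lookup_single when_def sum.delta in_keys_iff)

text \<open>A finitely supported map is the finite sum of its single terms, so additive claims need
  checking on single terms only.\<close>

lemma poly_mapping_add_induct [case_names single add]:
  fixes p :: "'a \<Rightarrow>\<^sub>0 'b::comm_monoid_add"
  assumes "\<And>m c. P (Poly_Mapping.single m c)" "\<And>p q. P p \<Longrightarrow> P q \<Longrightarrow> P (p + q)"
  shows "P p"
proof -
  have "P (\<Sum>k \<in> K. Poly_Mapping.single k (Poly_Mapping.lookup p k))" if "finite K" for K
    using that
  proof induction
    case empty
    \<comment> \<open>The empty sum is a single term with coefficient 0, at an arbitrary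
      index.\<close>
    show ?case using assms(1)[of undefined 0] by simp
  qed (use assms in auto)
  from this[of "Poly_Mapping.keys p"] show ?thesis by (simp add: poly_mapping_sum_single)
qed

text \<open>Both sides are additive in each factor, which reduces the claim to two single terms,
  where it is the addition rule for exponents.\<close>

lemma zpoly_eval_mult [simp]: "zpoly_eval f (p * q) = zpoly_eval f p * zpoly_eval f q"
proof (induction p rule: poly_mapping_add_induct)
  case (single m c)
  show ?case
    by (induction q rule: poly_mapping_add_induct)
       (auto simp: mult_single monom_value_add algebra_simps)
qed (auto simp: algebra_simps)

lemma single_zero_int: "Poly_Mapping.single 0 (c::int) = of_int c"
  using single_of_int[of c, where 'b = int] by simp

lemma zpoly_eval_of_int [simp]: "zpoly_eval f (of_int c) = of_int c"
  by (simp add: single_zero_int[symmetric])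

lemma zpoly_eval_zero [simp]: "zpoly_eval f 0 = 0"
  using zpoly_eval_of_int[of f 0] by simp

lemma zpoly_eval_one [simp]: "zpoly_eval f 1 = 1"
  using zpoly_eval_of_int[of f 1] by simp

lemma zpoly_eval_numeral [simp]: "zpoly_eval f (numeral n) = numeral n"
  using zpoly_eval_of_int[of f "numeral n"] by simp

lemma zpoly_eval_uminus [simp]: "zpoly_eval f (- p) = - zpoly_eval f p"
  using zpoly_eval_add[of f p "-p"] by (simp add: eq_neg_iff_add_eq_0 add.commute)

lemma zpoly_eval_diff [simp]: "zpoly_eval f (p - q) = zpoly_eval f p - zpoly_eval f q"
  using zpoly_eval_add[of f p "-q"] by simp

lemma zpoly_eval_power [simp]: "zpoly_eval f (p ^ n) = zpoly_eval f p ^ n"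
  by (induction n) auto

lemma zpoly_eval_Var [simp]: "zpoly_eval f (Var v) = f v"
  by (simp add: Var_def)

section \<open>Polynomials in a prescribed set of indeterminates\<close>

definition polys :: "'v set \<Rightarrow> 'v zpoly set" where
  "polys V = {p. zpoly_vars p \<subseteq> V}"

lemma carrier_zpoly_ring [simp]: "carrier (zpoly_ring V) = polys V"
  and mult_zpoly_ring [simp]: "p \<otimes>\<^bsub>zpoly_ring V\<^esub> q = p * q"
  and one_zpoly_ring [simp]: "\<one>\<^bsub>zpoly_ring V\<^esub> = 1"
  and add_zpoly_ring [simp]: "p \<oplus>\<^bsub>zpoly_ring V\<^esub> q = p + q"
  and zero_zpoly_ring [simp]: "\<zero>\<^bsub>zpoly_ring V\<^esub> = 0"
  by (simp_all add: zpoly_ring_def polys_def)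

lemma polys_iff: "p \<in> polys V \<longleftrightarrow> (\<forall>m\<in>Poly_Mapping.keys p. Poly_Mapping.keys m \<subseteq> V)"
  by (auto simp: polys_def zpoly_vars_def)

lemma polys_mono: "V \<subseteq> W \<Longrightarrow> polys V \<subseteq> polys W"
  by (auto simp: polys_def)

lemma polys_single:
  "Poly_Mapping.keys m \<subseteq> V \<Longrightarrow> Poly_Mapping.single m c \<in> polys V"
  by (auto simp: polys_def zpoly_vars_def)

lemma polys_add [intro]: "p \<in> polys V \<Longrightarrow> q \<in> polys V \<Longrightarrow> p + q \<in> polys V"
  using Poly_Mapping.keys_add[of p q] unfolding polys_iff by blast

lemma polys_mult [intro]: "p \<in> polys V \<Longrightarrow> q \<in> polys V \<Longrightarrow> p * q \<in> polys V"
proof -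
  assume *: "p \<in> polys V" "q \<in> polys V"
  show ?thesis unfolding polys_iff
  proof
    fix m assume "m \<in> Poly_Mapping.keys (p * q)"
    then obtain a b where "m = a + b" "a \<in> Poly_Mapping.keys p" "b \<in> Poly_Mapping.keys q"
      using Poly_Mapping.keys_mult[of p q] by auto
    then show "Poly_Mapping.keys m \<subseteq> V"
      using * Poly_Mapping.keys_add[of a b] unfolding polys_iff by blast
  qed
qed

lemma polys_of_int [intro, simp]: "of_int c \<in> polys V"
  using polys_single[of 0 V c] by (simp add: single_zero_int)

lemma polys_zero [intro, simp]: "0 \<in> polys V"
  using polys_of_int[of 0] by simp

lemma polys_one [intro, simp]: "1 \<in> polys V"
  using polys_of_int[of 1] by simp

lemma polys_numeral [intro, simp]: "numeral n \<in> polys V"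
  using polys_of_int[of "numeral n"] by simp

lemma polys_uminus [intro]: "p \<in> polys V \<Longrightarrow> - p \<in> polys V"
  by (simp add: polys_def zpoly_vars_def)

lemma polys_diff [intro]: "p \<in> polys V \<Longrightarrow> q \<in> polys V \<Longrightarrow> p - q \<in> polys V"
  using polys_add[of p V "- q"] by auto

lemma polys_power [intro]: "p \<in> polys V \<Longrightarrow> p ^ n \<in> polys V"
  by (induction n) auto

lemma polys_Var [intro]: "v \<in> V \<Longrightarrow> Var v \<in> polys V"
  by (simp add: Var_def polys_single)

lemmas polys_intros = polys_add polys_mult polys_uminus polys_diff polys_power polys_Var
  polys_of_int polys_zero polys_one polys_numeral

lemma zpoly_eval_Var_self: "zpoly_eval Var p = p"
proof (induction p rule: poly_mapping_add_induct)
  case (single m c)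
  have pow: "Var v ^ n = Poly_Mapping.single (Poly_Mapping.single v n) 1" for v :: 'a and n
    by (induction n) (auto simp: Var_def mult_single single_add[symmetric])
  have "(\<Prod>v\<in>K. Var v ^ Poly_Mapping.lookup m v) =
      Poly_Mapping.single (\<Sum>v\<in>K. Poly_Mapping.single v (Poly_Mapping.lookup m v)) 1"
    if "finite K" for K
    using that by induction (auto simp: mult_single pow)
  then have "monom_value Var m = Poly_Mapping.single m 1"
    by (simp add: monom_value_def poly_mapping_sum_single)
  then show ?case
    by (simp add: single_zero_int[symmetric] mult_single)
qed auto

text \<open>Writing \<open>p\<close> as \<open>zpoly_eval Var p\<close>, its value at its own
  indeterminates, displays it as built from integers and elements of \<open>V\<close> by sums and
  products.\<close>

lemma polys_induct [consumes 1, case_names const var add mult]: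
  assumes "p \<in> polys V"
    and const: "\<And>c. P (of_int c)" and var: "\<And>v. v \<in> V \<Longrightarrow> P (Var v)"
    and add: "\<And>p q. p \<in> polys V \<Longrightarrow> q \<in> polys V \<Longrightarrow> P p \<Longrightarrow> P q \<Longrightarrow> P (p + q)"
    and mult: "\<And>p q. p \<in> polys V \<Longrightarrow> q \<in> polys V \<Longrightarrow> P p \<Longrightarrow> P q \<Longrightarrow> P (p * q)"
  shows "P p"
proof -
  \<comment> \<open>Membership is carried along because the cases for sums and products may assume
    it.\<close>
  define Q where "Q p \<longleftrightarrow> p \<in> polys V \<and> P p" for p
  have Q: "Q (of_int c)" "v \<in> V \<Longrightarrow> Q (Var v)" "Q x \<Longrightarrow> Q y \<Longrightarrow> Q (x + y)"
    "Q x \<Longrightarrow> Q y \<Longrightarrow> Q (x * y)" for c v x y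
    using assms by (auto simp: Q_def)
  have Q01: "Q 0" "Q 1" using Q(1)[of 0] Q(1)[of 1] by auto
  have pow: "Q x \<Longrightarrow> Q (x ^ n)" for x n by (induction n) (auto simp: Q01 Q(4))
  have prod: "Q (\<Prod>v\<in>K. g v)" if "finite K" "\<And>v. v \<in> K \<Longrightarrow> Q (g v)" for K :: "'a set" and g
    using that by (induction K) (auto simp: Q01 Q(4))
  have sum: "Q (\<Sum>v\<in>K. g v)" if "finite K" "\<And>v. v \<in> K \<Longrightarrow> Q (g v)"
    for K :: "('a \<Rightarrow>\<^sub>0 nat) set" and g
    using that by (induction K) (auto simp: Q01 Q(3))
  have "Q (zpoly_eval Var p)"
    unfolding zpoly_eval_def
  proof (intro sum Q(4) Q(1) prod pow Q(2) finite_keys)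
    fix m v
    assume "m \<in> Poly_Mapping.keys p" "v \<in> Poly_Mapping.keys m"
    then show "v \<in> V" using assms(1) unfolding polys_iff by blast
  qed
  then show ?thesis by (simp add: Q_def zpoly_eval_Var_self)
qed

lemma polys_UNIV [simp]: "polys UNIV = UNIV"
  by (auto simp: polys_def)

lemma zpoly_eval_cong:
  assumes "p \<in> polys V" "\<And>v. v \<in> V \<Longrightarrow> f v = g v"
  shows "zpoly_eval f p = zpoly_eval g p"
  using assms(1) by (induction rule: polys_induct) (auto simp: assms(2))

section \<open>Polynomials determined by their values\<close>

lemma poly_zpoly_eval:
  "poly (zpoly_eval f p) t = zpoly_eval (\<lambda>v. poly (f v) t) p"
proof -
  have "p \<in> polys UNIV" by simp
  then show ?thesis by (induction rule: polys_induct) auto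
qed

text \<open>Distinct monomials are distinct multiplicative characters, so Artin's argument for their
  linear independence applies.\<close>

lemma zpoly_eq_0_if_vanishing:
  assumes "\<And>x :: 'v \<Rightarrow> 'a::{idom,ring_char_0}. zpoly_eval x p = 0"
  shows "p = 0"
proof -
  have indep: "\<forall>k\<in>K. c k = 0"
    if "finite K" "\<And>x :: 'v \<Rightarrow> 'a. (\<Sum>k\<in>K. c k * monom_value x k) = 0" for K and c :: "_ \<Rightarrow> 'a"
    using that
  proof (induction K arbitrary: c rule: finite_induct)
    case (insert m K)
    have *: "c k = 0" if k: "k \<in> K" for k
    proof -
      have "k \<noteq> m" using k insert by auto
      then obtain v where v: "Poly_Mapping.lookup k v \<noteq> Poly_Mapping.lookup m v"
        using poly_mapping_eqI[of k m] by auto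
      \<comment> \<open>This point has coordinate 2 at an indeterminate where the exponents of
        \<open>k\<close> and \<open>m\<close> differ, and 1 elsewhere. In characteristic zero it
        separates the two monomials.\<close>
      define y :: "'v \<Rightarrow> 'a" where "y = (\<lambda>w. if w = v then 2 else 1)"
      have y: "monom_value y n = 2 ^ Poly_Mapping.lookup n v" for n
      proof -
        have "monom_value y n = (\<Prod>w\<in>insert v (Poly_Mapping.keys n). y w ^ Poly_Mapping.lookup n w)"
          by (rule monom_value_superset) auto
        also have "\<dots> = (\<Prod>w\<in>{v}. y w ^ Poly_Mapping.lookup n w)"
          by (rule prod.mono_neutral_right) (auto simp: y_def)
        finally show ?thesis by (simp add: y_def)
      qed
      have "monom_value y k \<noteq> monom_value y m"
      proof
        assume "monom_value y k = monom_value y m"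
        then have "(of_nat (2 ^ Poly_Mapping.lookup k v) :: 'a) = of_nat (2 ^ Poly_Mapping.lookup m v)"
          by (simp add: y)
        then show False using v by (simp only: of_nat_eq_iff) simp
      qed
      \<comment> \<open>Replace \<open>x\<close> by the product of \<open>x\<close> and
        \<open>y\<close> in the relation and subtract \<open>monom_value y m\<close> times the
        original relation. The term of \<open>m\<close> disappears and the induction hypothesis
        applies to the rest.\<close>
      moreover have "\<forall>k\<in>K. c k * (monom_value y k - monom_value y m) = 0"
      proof (rule insert.IH)
        fix x :: "'v \<Rightarrow> 'a"
        have mult: "monom_value (\<lambda>w. x w * y w) n = monom_value x n * monom_value y n" for n
          by (simp add: monom_value_def power_mult_distrib prod.distrib)
        have "(\<Sum>k\<in>K. c k * (monom_value y k - monom_value y m) * monom_value x k) =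
          (\<Sum>k\<in>insert m K. c k * monom_value (\<lambda>w. x w * y w) k)
            - monom_value y m * (\<Sum>k\<in>insert m K. c k * monom_value x k)"
          using insert.hyps
          by (simp add: mult sum_distrib_left algebra_simps sum_subtractf)
        then show "(\<Sum>k\<in>K. c k * (monom_value y k - monom_value y m) * monom_value x k) = 0"
          by (simp only: insert.prems) simp
      qed
      ultimately show ?thesis using k by auto
    qed
    moreover have "c m = 0"
      using insert.prems[of "\<lambda>_. 1"] insert.hyps * by (simp add: monom_value_def)
    ultimately show ?case by auto
  qed simp
  have "\<forall>k\<in>Poly_Mapping.keys p. (of_int (Poly_Mapping.lookup p k) :: 'a) = 0"
    by (rule indep) (use assms in \<open>auto simp: zpoly_eval_def monom_value_def\<close>)
  then show ?thesis by (intro poly_mapping_eqI) (auto simp: in_keys_iff)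
qed

text \<open>Restrict to the line joining the origin to \<open>x\<close>. There \<open>d\<close>
  becomes a nonzero polynomial in one variable, being nonzero at parameter 0, and its product with
  the restriction of \<open>f\<close> has only zero values. Hence \<open>f\<close> vanishes on the
  line, in particular at parameter 1.\<close>

lemma zpoly_eq_0_if_vanishing_generically:
  assumes d: "zpoly_eval (\<lambda>_. 0 :: 'a::{idom,ring_char_0}) d \<noteq> 0"
    and f: "\<And>x :: 'v \<Rightarrow> 'a. zpoly_eval x d \<noteq> 0 \<Longrightarrow> zpoly_eval x f = 0"
  shows "f = 0"
proof (rule zpoly_eq_0_if_vanishing)
  fix x :: "'v \<Rightarrow> 'a"
  define line where "line v = [:0, x v:]" for v
  have line: "poly (zpoly_eval line p) t = zpoly_eval (\<lambda>v. t * x v) p" for p t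
    by (simp add: poly_zpoly_eval line_def)
  have "zpoly_eval line d * zpoly_eval line f = 0"
  proof -
    have "poly (zpoly_eval line d * zpoly_eval line f) t = 0" for t
      using f[of "\<lambda>v. t * x v"] by (auto simp: line)
    then show ?thesis using poly_all_0_iff_0 by blast
  qed
  moreover have "poly (zpoly_eval line d) 0 \<noteq> 0"
    using d by (simp add: line)
  ultimately have "zpoly_eval line f = 0" by auto
  then have "poly (zpoly_eval line f) 1 = 0" by simp
  then show "zpoly_eval x f = 0" by (simp add: line)
qed

section \<open>Polynomial rings as algebraic structures\<close>

lemma cring_zpoly_ring: "cring (zpoly_ring V)"
proof (rule cringI)
  show "abelian_group (zpoly_ring V)"
  proof (rule abelian_groupI)
    fix p assume "p \<in> carrier (zpoly_ring V)"
    then show "\<exists>y\<in>carrier (zpoly_ring V). y \<oplus>\<^bsub>zpoly_ring V\<^esub> p = \<zero>\<^bsub>zpoly_ring V\<^esub>"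
      by (intro bexI[of _ "- p"]) auto
  qed (auto simp: algebra_simps)
  show "Group.comm_monoid (zpoly_ring V)"
    by (rule comm_monoidI) (auto simp: algebra_simps)
qed (auto simp: algebra_simps)

lemma a_inv_zpoly_ring:
  assumes "p \<in> polys V"
  shows "\<ominus>\<^bsub>zpoly_ring V\<^esub> p = - p"
proof -
  interpret cring "zpoly_ring V" by (rule cring_zpoly_ring)
  have "(- p) \<oplus>\<^bsub>zpoly_ring V\<^esub> p = \<zero>\<^bsub>zpoly_ring V\<^esub>" by simp
  then show ?thesis using assms by (intro minus_equality) (auto simp: polys_uminus)
qed

text \<open>The uniqueness half of the universal property of polynomial rings, which holds because
  integers and indeterminates generate.\<close>

lemma zpoly_ring_hom_eq:
  assumes "cring R" and g: "g \<in> ring_hom (zpoly_ring V) R" and h: "h \<in> ring_hom (zpoly_ring V) R"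
    and Var: "\<And>v. v \<in> V \<Longrightarrow> g (Var v) = h (Var v)" and p: "p \<in> polys V"
  shows "g p = h p"
proof -
  interpret R: cring R by fact
  interpret Z: cring "zpoly_ring V" by (rule cring_zpoly_ring)
  interpret g: ring_hom_cring "zpoly_ring V" R g using g by unfold_locales
  interpret h: ring_hom_cring "zpoly_ring V" R h using h by unfold_locales
  have add: "g (p + q) = g p \<oplus>\<^bsub>R\<^esub> g q" "h (p + q) = h p \<oplus>\<^bsub>R\<^esub> h q"
    and mult: "g (p * q) = g p \<otimes>\<^bsub>R\<^esub> g q" "h (p * q) = h p \<otimes>\<^bsub>R\<^esub> h q"
    if "p \<in> polys V" "q \<in> polys V" for p q
    using that g.hom_add h.hom_add g.hom_mult h.hom_mult by force+
  \<comment> \<open>Integer constants are reached by repeatedly adding 1, and by negation.\<close>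
  have nat: "g (of_nat n) = h (of_nat n)" "of_nat n \<in> polys V" for n
  proof (induction n)
    case 0
    show "g (of_nat 0) = h (of_nat 0)" using g.hom_zero h.hom_zero by simp
  next
    case (Suc n)
    show "g (of_nat (Suc n)) = h (of_nat (Suc n))"
      using Suc g.hom_one h.hom_one by (simp add: add)
  qed auto
  have uminus: "g (- p) = \<ominus>\<^bsub>R\<^esub> g p" "h (- p) = \<ominus>\<^bsub>R\<^esub> h p" if "p \<in> polys V" for p
    using that g.hom_a_inv[of p] h.hom_a_inv[of p] by (simp_all add: a_inv_zpoly_ring)
  show ?thesis using p
  proof (induction rule: polys_induct)
    case (const c)
    show ?case
      by (cases c rule: int_cases2) (simp_all add: nat uminus)
  qed (simp_all add: Var add mult)
qed

text \<open>Division works over the integers because the divisor is monic. The polynomials of the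
  required form include the generators and are closed under sums and products, so no degree in
  \<open>z\<close> has to be introduced.\<close>

lemma polys_monic_quadratic_division:
  fixes z :: 'v
  assumes p: "p \<in> polys (V - {z})" and s: "s \<in> polys (V - {z})" and z: "z \<in> V"
    and f: "f \<in> polys V"
  obtains a b q where "a \<in> polys (V - {z})" "b \<in> polys (V - {z})" "q \<in> polys V"
    "f = a + b * Var z + q * ((Var z)^2 + p * Var z + s)"
proof -
  let ?P = "polys (V - {z}) :: 'v zpoly set" and ?\<phi> = "(Var z)^2 + p * Var z + s"
  have sub: "?P \<subseteq> polys V" by (rule polys_mono) auto
  have zV: "Var z \<in> polys V" using z by auto
  have "\<exists>a\<in>?P. \<exists>b\<in>?P. \<exists>q\<in>polys V. f = a + b * Var z + q * ?\<phi>"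
    using f
  proof (induction rule: polys_induct)
    case (const c)
    show ?case by (rule bexI[of _ "of_int c"], rule bexI[of _ 0], rule bexI[of _ 0]) auto
  next
    case (var v)
    show ?case
    proof (cases "v = z")
      case True
      show ?thesis
        by (rule bexI[of _ 0], rule bexI[of _ 1], rule bexI[of _ 0]) (auto simp: True)
    next
      case False
      show ?thesis
        by (rule bexI[of _ "Var v"], rule bexI[of _ 0], rule bexI[of _ 0]) (use False var in auto)
    qed
  next
    case (add f g)
    then obtain a b q c d r where P: "a \<in> ?P" "b \<in> ?P" "c \<in> ?P" "d \<in> ?P" "q \<in> polys V" "r \<in> polys V"
      and fg: "f = a + b * Var z + q * ?\<phi>" "g = c + d * Var z + r * ?\<phi>"
      by blast
    have "f + g = (a + c) + (b + d) * Var z + (q + r) * ?\<phi>"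
      unfolding fg by (simp add: algebra_simps)
    then show ?case using P by (meson polys_add)
  next
    case (mult f g)
    then obtain a b q c d r where P: "a \<in> ?P" "b \<in> ?P" "c \<in> ?P" "d \<in> ?P" "q \<in> polys V" "r \<in> polys V"
      and fg: "f = a + b * Var z + q * ?\<phi>" "g = c + d * Var z + r * ?\<phi>"
      by blast
    \<comment> \<open>The square of \<open>Var z\<close> is replaced by the divisor minus
      \<open>p * Var z + s\<close>.\<close>
    have "f * g = (a * c - b * d * s) + (a * d + b * c - b * d * p) * Var z
        + (b * d + q * g + (a + b * Var z) * r) * ?\<phi>"
      unfolding fg by (simp add: algebra_simps power2_eq_square)
    moreover have "a * c - b * d * s \<in> ?P" "a * d + b * c - b * d * p \<in> ?P"
      by (intro polys_intros P p s)+
    moreover have "b * d + q * g + (a + b * Var z) * r \<in> polys V"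
      by (intro polys_intros subsetD[OF sub] P zV mult.hyps)
    ultimately show ?case by blast
  qed
  then show ?thesis using that by blast
qed

section \<open>Localisation of commutative rings\<close>

locale cring_localisation = cring R for R (structure) +
  fixes S :: "'a set"
  assumes S_carrier: "S \<subseteq> carrier R" and S_one: "\<one> \<in> S"
    and S_mult: "s \<in> S \<Longrightarrow> t \<in> S \<Longrightarrow> s \<otimes> t \<in> S"
begin

lemma S_in_carrier: "s \<in> S \<Longrightarrow> s \<in> carrier R"
  using S_carrier by auto

abbreviation frac :: "'a \<Rightarrow> 'a \<Rightarrow> ('a \<times> 'a) set" where
  "frac \<equiv> fraction R S"

lemma mem_frac_iff:
  "(b, t) \<in> frac a s \<longleftrightarrow>
     b \<in> carrier R \<and> t \<in> S \<and> (\<exists>u\<in>S. u \<otimes> (t \<otimes> a \<ominus> s \<otimes> b) = \<zero>)"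
  by (simp add: fraction_def)

lemma mem_frac_self: "a \<in> carrier R \<Longrightarrow> s \<in> S \<Longrightarrow> (a, s) \<in> frac a s"
  unfolding mem_frac_iff using S_one S_in_carrier by (auto intro!: bexI[of _ \<one>] simp: r_right_minus_eq)

text \<open>This is transitivity of the relation that defines fractions.\<close>

lemma frac_subset:
  assumes "a \<in> carrier R" "s \<in> S" "b \<in> carrier R" "t \<in> S"
    "u \<in> S" "u \<otimes> (t \<otimes> a \<ominus> s \<otimes> b) = \<zero>"
  shows "frac b t \<subseteq> frac a s"
proof
  fix z assume "z \<in> frac b t"
  then obtain c w v where z: "z = (c, w)" "c \<in> carrier R" "w \<in> S" "v \<in> S"
    "v \<otimes> (w \<otimes> b \<ominus> t \<otimes> c) = \<zero>"
    by (auto simp: fraction_def)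
  have c: "a \<in> carrier R" "s \<in> carrier R" "b \<in> carrier R" "t \<in> carrier R" "u \<in> carrier R"
    "v \<in> carrier R" "w \<in> carrier R" "c \<in> carrier R"
    using assms z S_in_carrier by auto
  \<comment> \<open>With the annihilator \<open>u v t\<close>, the two given relations add up and
    the terms containing \<open>b\<close> cancel.\<close>
  have "(u \<otimes> v \<otimes> t) \<otimes> (w \<otimes> a \<ominus> s \<otimes> c) =
      (v \<otimes> w) \<otimes> (u \<otimes> (t \<otimes> a \<ominus> s \<otimes> b)) \<oplus> (u \<otimes> s) \<otimes> (v \<otimes> (w \<otimes> b \<ominus> t \<otimes> c))"
    using c by algebra
  also have "\<dots> = \<zero>" using c by (simp only: assms z) simp
  finally show "z \<in> frac a s"
    using z assms S_mult unfolding mem_frac_iff z(1) by blast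
qed

lemma frac_eq_iff:
  assumes "a \<in> carrier R" "s \<in> S" "b \<in> carrier R" "t \<in> S"
  shows "frac a s = frac b t \<longleftrightarrow> (\<exists>u\<in>S. u \<otimes> (t \<otimes> a \<ominus> s \<otimes> b) = \<zero>)"
proof
  assume "frac a s = frac b t"
  then have "(b, t) \<in> frac a s" using mem_frac_self assms by simp
  then show "\<exists>u\<in>S. u \<otimes> (t \<otimes> a \<ominus> s \<otimes> b) = \<zero>" by (simp add: mem_frac_iff)
next
  assume "\<exists>u\<in>S. u \<otimes> (t \<otimes> a \<ominus> s \<otimes> b) = \<zero>"
  then obtain u where u: "u \<in> S" "u \<otimes> (t \<otimes> a \<ominus> s \<otimes> b) = \<zero>" by blast
  have "u \<otimes> (s \<otimes> b \<ominus> t \<otimes> a) = \<ominus> (u \<otimes> (t \<otimes> a \<ominus> s \<otimes> b))"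
    using assms u(1) S_in_carrier by algebra
  then have "u \<otimes> (s \<otimes> b \<ominus> t \<otimes> a) = \<zero>" using u by simp
  then show "frac a s = frac b t"
    using frac_subset[OF assms u] frac_subset[OF assms(3,4,1,2) u(1)] by auto
qed

lemma frac_eqI:
  assumes "a \<in> carrier R" "s \<in> S" "b \<in> carrier R" "t \<in> S" "t \<otimes> a = s \<otimes> b"
  shows "frac a s = frac b t"
  using assms S_one S_in_carrier
  by (subst frac_eq_iff) (auto intro!: bexI[of _ \<one>] simp: r_right_minus_eq)

lemma frac_eq_of_mem: "a \<in> carrier R \<Longrightarrow> s \<in> S \<Longrightarrow> (b, t) \<in> frac a s \<Longrightarrow> frac b t = frac a s"
  using frac_eq_iff by (metis mem_frac_iff)

lemma carrier_localisation:
  "carrier (localisation R S) = {frac a s | a s. a \<in> carrier R \<and> s \<in> S}"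
  by (simp add: localisation_def)

lemma frac_in_carrier [simp]:
  "a \<in> carrier R \<Longrightarrow> s \<in> S \<Longrightarrow> frac a s \<in> carrier (localisation R S)"
  by (auto simp: carrier_localisation)

lemma localisation_cases:
  assumes "X \<in> carrier (localisation R S)"
  obtains a s where "a \<in> carrier R" "s \<in> S" "X = frac a s"
  using assms by (auto simp: carrier_localisation)

lemma one_localisation: "\<one>\<^bsub>localisation R S\<^esub> = frac \<one> \<one>"
  and zero_localisation: "\<zero>\<^bsub>localisation R S\<^esub> = frac \<zero> \<one>"
  by (simp_all add: localisation_def)

text \<open>The operations of \<open>localisation\<close> are unions over representatives. A
  nonempty union of equal sets is their common value, so only independence of representatives
  remains to be shown.\<close>

lemma UN_frac_eq:
  assumes "a \<in> carrier R" "s \<in> S"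
    "\<And>a' s'. a' \<in> carrier R \<Longrightarrow> s' \<in> S \<Longrightarrow> frac a' s' = frac a s \<Longrightarrow> F a' s' = C"
  shows "(\<Union>(a', s')\<in>frac a s. F a' s') = C"
proof -
  have "F a' s' = C" if "(a', s') \<in> frac a s" for a' s'
    using assms(3)[of a' s'] frac_eq_of_mem[OF assms(1,2) that] that by (simp add: mem_frac_iff)
  then show ?thesis using mem_frac_self[OF assms(1,2)] by fastforce
qed

text \<open>The product of the two annihilators works: the difference is split by changing one
  factor at a time. The same product serves for sums.\<close>

lemma frac_mult_cong:
  assumes "a \<in> carrier R" "s \<in> S" "b \<in> carrier R" "t \<in> S"
    and "a' \<in> carrier R" "s' \<in> S" "b' \<in> carrier R" "t' \<in> S"
    and "frac a' s' = frac a s" "frac b' t' = frac b t"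
  shows "frac (a' \<otimes> b') (s' \<otimes> t') = frac (a \<otimes> b) (s \<otimes> t)"
proof -
  obtain u v where u: "u \<in> S" "u \<otimes> (s \<otimes> a' \<ominus> s' \<otimes> a) = \<zero>"
    and v: "v \<in> S" "v \<otimes> (t \<otimes> b' \<ominus> t' \<otimes> b) = \<zero>"
    using assms frac_eq_iff by metis
  have c: "a \<in> carrier R" "s \<in> carrier R" "b \<in> carrier R" "t \<in> carrier R" "u \<in> carrier R"
    "a' \<in> carrier R" "s' \<in> carrier R" "b' \<in> carrier R" "t' \<in> carrier R" "v \<in> carrier R"
    using assms u v S_in_carrier by auto
  have "(u \<otimes> v) \<otimes> ((s \<otimes> t) \<otimes> (a' \<otimes> b') \<ominus> (s' \<otimes> t') \<otimes> (a \<otimes> b)) =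
    (v \<otimes> t \<otimes> b') \<otimes> (u \<otimes> (s \<otimes> a' \<ominus> s' \<otimes> a)) \<oplus> (u \<otimes> s' \<otimes> a) \<otimes> (v \<otimes> (t \<otimes> b' \<ominus> t' \<otimes> b))"
    using c by algebra
  also have "\<dots> = \<zero>" using c by (simp only: u v) simp
  finally show ?thesis
    using assms u(1) v(1) S_mult by (subst frac_eq_iff) (auto intro!: bexI[of _ "u \<otimes> v"])
qed

lemma frac_add_cong:
  assumes "a \<in> carrier R" "s \<in> S" "b \<in> carrier R" "t \<in> S"
    and "a' \<in> carrier R" "s' \<in> S" "b' \<in> carrier R" "t' \<in> S"
    and "frac a' s' = frac a s" "frac b' t' = frac b t"
  shows "frac (t' \<otimes> a' \<oplus> s' \<otimes> b') (s' \<otimes> t') = frac (t \<otimes> a \<oplus> s \<otimes> b) (s \<otimes> t)"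
proof -
  obtain u v where u: "u \<in> S" "u \<otimes> (s \<otimes> a' \<ominus> s' \<otimes> a) = \<zero>"
    and v: "v \<in> S" "v \<otimes> (t \<otimes> b' \<ominus> t' \<otimes> b) = \<zero>"
    using assms frac_eq_iff by metis
  have c: "a \<in> carrier R" "s \<in> carrier R" "b \<in> carrier R" "t \<in> carrier R" "u \<in> carrier R"
    "a' \<in> carrier R" "s' \<in> carrier R" "b' \<in> carrier R" "t' \<in> carrier R" "v \<in> carrier R"
    using assms u v S_in_carrier by auto
  have "(u \<otimes> v) \<otimes> ((s \<otimes> t) \<otimes> (t' \<otimes> a' \<oplus> s' \<otimes> b') \<ominus> (s' \<otimes> t') \<otimes> (t \<otimes> a \<oplus> s \<otimes> b)) =
    (v \<otimes> t \<otimes> t') \<otimes> (u \<otimes> (s \<otimes> a' \<ominus> s' \<otimes> a)) \<oplus> (u \<otimes> s' \<otimes> s) \<otimes> (v \<otimes> (t \<otimes> b' \<ominus> t' \<otimes> b))"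
    using c by algebra
  also have "\<dots> = \<zero>" using c by (simp only: u v) simp
  finally show ?thesis
    using assms u(1) v(1) S_mult c by (subst frac_eq_iff) (auto intro!: bexI[of _ "u \<otimes> v"])
qed

lemma frac_mult:
  assumes "a \<in> carrier R" "s \<in> S" "b \<in> carrier R" "t \<in> S"
  shows "frac a s \<otimes>\<^bsub>localisation R S\<^esub> frac b t = frac (a \<otimes> b) (s \<otimes> t)"
  unfolding localisation_def by (simp, intro UN_frac_eq frac_mult_cong assms)

lemma frac_add:
  assumes "a \<in> carrier R" "s \<in> S" "b \<in> carrier R" "t \<in> S"
  shows "frac a s \<oplus>\<^bsub>localisation R S\<^esub> frac b t = frac (t \<otimes> a \<oplus> s \<otimes> b) (s \<otimes> t)"
  unfolding localisation_def by (simp, intro UN_frac_eq frac_add_cong assms)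

lemma cring_localisation: "cring (localisation R S)"
proof -
  note [simp] = S_mult S_one S_in_carrier
  show ?thesis
  proof (rule cringI)
    show "abelian_group (localisation R S)"
    proof (rule abelian_groupI)
      fix X Y Z
      assume "X \<in> carrier (localisation R S)" "Y \<in> carrier (localisation R S)"
        "Z \<in> carrier (localisation R S)"
      then obtain a s b t c w where *: "a \<in> carrier R" "s \<in> S" "X = frac a s"
        "b \<in> carrier R" "t \<in> S" "Y = frac b t" "c \<in> carrier R" "w \<in> S" "Z = frac c w"
        by (metis localisation_cases)
      then have **: "s \<in> carrier R" "t \<in> carrier R" "w \<in> carrier R" by auto
      show "X \<oplus>\<^bsub>localisation R S\<^esub> Y \<in> carrier (localisation R S)"
        using * by (simp add: frac_add)
      show "X \<oplus>\<^bsub>localisation R S\<^esub> Y \<oplus>\<^bsub>localisation R S\<^esub> Z =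
            X \<oplus>\<^bsub>localisation R S\<^esub> (Y \<oplus>\<^bsub>localisation R S\<^esub> Z)"
        using * by (simp add: frac_add, intro frac_eqI, simp_all) (use *(1,4,7) ** in algebra)
      show "X \<oplus>\<^bsub>localisation R S\<^esub> Y = Y \<oplus>\<^bsub>localisation R S\<^esub> X"
        using * by (simp add: frac_add, intro frac_eqI, simp_all) (use *(1,4) ** in algebra)
      show "\<zero>\<^bsub>localisation R S\<^esub> \<oplus>\<^bsub>localisation R S\<^esub> X = X"
        using * by (simp add: frac_add zero_localisation)
      have "s \<otimes> (s \<otimes> \<ominus> a \<oplus> s \<otimes> a) = \<zero>" using *(1) ** by algebra
      then have "frac (\<ominus> a) s \<oplus>\<^bsub>localisation R S\<^esub> X = frac \<zero> \<one>"
        using * by (simp add: frac_add, intro frac_eqI, simp_all) (use *(1) ** in algebra)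
      then show "\<exists>Y\<in>carrier (localisation R S). Y \<oplus>\<^bsub>localisation R S\<^esub> X = \<zero>\<^bsub>localisation R S\<^esub>"
        using * by (intro bexI[of _ "frac (\<ominus> a) s"]) (simp_all add: zero_localisation)
    qed (simp add: zero_localisation)
    show "Group.comm_monoid (localisation R S)"
    proof (rule comm_monoidI)
      fix X Y Z
      assume "X \<in> carrier (localisation R S)" "Y \<in> carrier (localisation R S)"
        "Z \<in> carrier (localisation R S)"
      then obtain a s b t c w where *: "a \<in> carrier R" "s \<in> S" "X = frac a s"
        "b \<in> carrier R" "t \<in> S" "Y = frac b t" "c \<in> carrier R" "w \<in> S" "Z = frac c w"
        by (metis localisation_cases)
      show "X \<otimes>\<^bsub>localisation R S\<^esub> Y \<in> carrier (localisation R S)"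
        using * by (simp add: frac_mult)
      show "X \<otimes>\<^bsub>localisation R S\<^esub> Y \<otimes>\<^bsub>localisation R S\<^esub> Z =
            X \<otimes>\<^bsub>localisation R S\<^esub> (Y \<otimes>\<^bsub>localisation R S\<^esub> Z)"
        using * by (simp add: frac_mult m_assoc)
      show "X \<otimes>\<^bsub>localisation R S\<^esub> Y = Y \<otimes>\<^bsub>localisation R S\<^esub> X"
        using * by (simp add: frac_mult m_comm)
      show "\<one>\<^bsub>localisation R S\<^esub> \<otimes>\<^bsub>localisation R S\<^esub> X = X"
        using * by (simp add: frac_mult one_localisation)
    qed (simp add: one_localisation)
    fix X Y Z
    assume "X \<in> carrier (localisation R S)" "Y \<in> carrier (localisation R S)"
      "Z \<in> carrier (localisation R S)"
    then obtain a s b t c w where *: "a \<in> carrier R" "s \<in> S" "X = frac a s"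
      "b \<in> carrier R" "t \<in> S" "Y = frac b t" "c \<in> carrier R" "w \<in> S" "Z = frac c w"
      by (metis localisation_cases)
    then have **: "s \<in> carrier R" "t \<in> carrier R" "w \<in> carrier R" by auto
    show "(X \<oplus>\<^bsub>localisation R S\<^esub> Y) \<otimes>\<^bsub>localisation R S\<^esub> Z =
        X \<otimes>\<^bsub>localisation R S\<^esub> Z \<oplus>\<^bsub>localisation R S\<^esub> Y \<otimes>\<^bsub>localisation R S\<^esub> Z"
      using * by (simp add: frac_mult frac_add, intro frac_eqI, simp_all)
        (use *(1,4,7) ** in algebra)
  qed
qed

lemma frac_one_ring_hom: "(\<lambda>a. frac a \<one>) \<in> ring_hom R (localisation R S)"
  using S_one by (intro ring_hom_memI) (auto simp: frac_mult frac_add one_localisation)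

end

lemma (in cring) cring_localisation_powers:
  assumes "r \<in> carrier R"
  shows "cring_localisation R (powers_of R r)"
proof (unfold_locales)
  show "powers_of R r \<subseteq> carrier R" using assms by (auto simp: powers_of_def)
  show "\<one> \<in> powers_of R r" by (auto simp: powers_of_def intro: exI[of _ "0::nat"])
  show "s \<otimes> t \<in> powers_of R r" if "s \<in> powers_of R r" "t \<in> powers_of R r" for s t
    using that assms nat_pow_mult by (force simp: powers_of_def)
qed

text \<open>Equality of fractions is an annihilation condition, which an injective homomorphism
  preserves in both directions. Surjectivity is required only up to powers of
  \<open>\<psi> r\<close>, since these become invertible.\<close>

lemma localisation_at_iso:
  assumes "cring R" "cring R'" and r: "r \<in> carrier R"
    and \<psi>: "\<psi> \<in> ring_hom R R'" "inj_on \<psi> (carrier R)"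
    and surj: "\<And>b. b \<in> carrier R' \<Longrightarrow>
      \<exists>(n::nat). \<exists>a\<in>carrier R. \<psi> r [^]\<^bsub>R'\<^esub> n \<otimes>\<^bsub>R'\<^esub> b = \<psi> a"
  shows "\<exists>h \<in> ring_iso (localisation_at R r) (localisation_at R' (\<psi> r)).
    \<forall>a\<in>carrier R. h (to_localisation_at R r a) = to_localisation_at R' (\<psi> r) (\<psi> a)"
proof -
  define S where "S = powers_of R r"
  define S' where "S' = powers_of R' (\<psi> r)"
  interpret R: cring R by fact
  interpret R': cring R' by fact
  interpret \<psi>: ring_hom_cring R R' \<psi>
    using \<psi>(1) by unfold_locales
  interpret L: cring_localisation R S
    unfolding S_def by (rule R.cring_localisation_powers[OF r])
  interpret L': cring_localisation R' S'
    unfolding S'_def by (rule R'.cring_localisation_powers) (use r in simp)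
  have hom_pow: "\<psi> (r [^]\<^bsub>R\<^esub> n) = \<psi> r [^]\<^bsub>R'\<^esub> n" for n :: nat
    using r by (induction n) simp_all
  have \<psi>S: "\<psi> s \<in> S'" if "s \<in> S" for s
    using that r by (auto simp: S_def S'_def powers_of_def hom_pow)
  note [simp] = L.S_in_carrier L'.S_in_carrier L.S_mult L'.S_mult L.S_one L'.S_one \<psi>S
  define h where "h X = (\<Union>(a, s)\<in>X. L'.frac (\<psi> a) (\<psi> s))" for X
  \<comment> \<open>Read from right to left this makes \<open>h\<close> well defined, from left to
    right injective.\<close>
  have eq_iff: "L'.frac (\<psi> a) (\<psi> s) = L'.frac (\<psi> b) (\<psi> t) \<longleftrightarrow> L.frac a s = L.frac b t"
    if "a \<in> carrier R" "s \<in> S" "b \<in> carrier R" "t \<in> S" for a s b t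
  proof -
    have iff: "\<psi> u \<otimes>\<^bsub>R'\<^esub> (\<psi> t \<otimes>\<^bsub>R'\<^esub> \<psi> a \<ominus>\<^bsub>R'\<^esub> \<psi> s \<otimes>\<^bsub>R'\<^esub> \<psi> b) = \<zero>\<^bsub>R'\<^esub> \<longleftrightarrow>
       u \<otimes>\<^bsub>R\<^esub> (t \<otimes>\<^bsub>R\<^esub> a \<ominus>\<^bsub>R\<^esub> s \<otimes>\<^bsub>R\<^esub> b) = \<zero>\<^bsub>R\<^esub>" if "u \<in> S" for u
    proof -
      have "\<psi> u \<otimes>\<^bsub>R'\<^esub> (\<psi> t \<otimes>\<^bsub>R'\<^esub> \<psi> a \<ominus>\<^bsub>R'\<^esub> \<psi> s \<otimes>\<^bsub>R'\<^esub> \<psi> b) =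
          \<psi> (u \<otimes>\<^bsub>R\<^esub> (t \<otimes>\<^bsub>R\<^esub> a \<ominus>\<^bsub>R\<^esub> s \<otimes>\<^bsub>R\<^esub> b))"
        using that \<open>a \<in> carrier R\<close> \<open>s \<in> S\<close> \<open>b \<in> carrier R\<close> \<open>t \<in> S\<close> by (simp add: R.minus_eq R'.minus_eq)
      moreover have "u \<otimes>\<^bsub>R\<^esub> (t \<otimes>\<^bsub>R\<^esub> a \<ominus>\<^bsub>R\<^esub> s \<otimes>\<^bsub>R\<^esub> b) \<in> carrier R"
        using that \<open>a \<in> carrier R\<close> \<open>s \<in> S\<close> \<open>b \<in> carrier R\<close> \<open>t \<in> S\<close> by simp
      ultimately show ?thesis
        using \<psi>(2) by (metis R.zero_closed \<psi>.hom_zero inj_on_contraD)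
    qed
    have S'_eq: "S' = \<psi> ` S"
      by (simp add: S_def S'_def powers_of_def full_SetCompr_eq image_image hom_pow)
    have "L'.frac (\<psi> a) (\<psi> s) = L'.frac (\<psi> b) (\<psi> t) \<longleftrightarrow>
        (\<exists>u\<in>S'. u \<otimes>\<^bsub>R'\<^esub> (\<psi> t \<otimes>\<^bsub>R'\<^esub> \<psi> a \<ominus>\<^bsub>R'\<^esub> \<psi> s \<otimes>\<^bsub>R'\<^esub> \<psi> b) = \<zero>\<^bsub>R'\<^esub>)"
      using that by (intro L'.frac_eq_iff) simp_all
    also have "\<dots> \<longleftrightarrow> (\<exists>u\<in>S. u \<otimes>\<^bsub>R\<^esub> (t \<otimes>\<^bsub>R\<^esub> a \<ominus>\<^bsub>R\<^esub> s \<otimes>\<^bsub>R\<^esub> b) = \<zero>\<^bsub>R\<^esub>)"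
      by (simp add: S'_eq iff)
    also have "\<dots> \<longleftrightarrow> L.frac a s = L.frac b t"
      using that by (intro L.frac_eq_iff[symmetric])
    finally show ?thesis .
  qed
  have h: "h (L.frac a s) = L'.frac (\<psi> a) (\<psi> s)" if "a \<in> carrier R" "s \<in> S" for a s
    unfolding h_def using that by (intro L.UN_frac_eq) (simp_all add: eq_iff)
  have "h \<in> ring_hom (localisation R S) (localisation R' S')"
  proof (rule ring_hom_memI)
    fix X Y
    assume "X \<in> carrier (localisation R S)" "Y \<in> carrier (localisation R S)"
    then obtain a s b t where *: "a \<in> carrier R" "s \<in> S" "X = L.frac a s"
        "b \<in> carrier R" "t \<in> S" "Y = L.frac b t"
      by (metis L.localisation_cases)
    show "h X \<in> carrier (localisation R' S')"
      using * by (simp add: h)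
    show "h (X \<otimes>\<^bsub>localisation R S\<^esub> Y) = h X \<otimes>\<^bsub>localisation R' S'\<^esub> h Y"
      using * by (simp add: h L.frac_mult L'.frac_mult)
    show "h (X \<oplus>\<^bsub>localisation R S\<^esub> Y) = h X \<oplus>\<^bsub>localisation R' S'\<^esub> h Y"
      using * by (simp add: h L.frac_add L'.frac_add)
  qed (simp add: h L.one_localisation L'.one_localisation)
  moreover have "inj_on h (carrier (localisation R S))"
    by (rule inj_onI) (auto simp: h eq_iff elim!: L.localisation_cases)
  moreover have "\<exists>X\<in>carrier (localisation R S). h X = Y"
    if "Y \<in> carrier (localisation R' S')" for Y
  proof -
    obtain b s' where b: "b \<in> carrier R'" "s' \<in> S'" "Y = L'.frac b s'"
      using \<open>Y \<in> carrier (localisation R' S')\<close> by (rule L'.localisation_cases)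
    obtain n where n: "s' = \<psi> r [^]\<^bsub>R'\<^esub> (n::nat)"
      using b(2) by (auto simp: S'_def powers_of_def)
    obtain k a where a: "a \<in> carrier R" "\<psi> r [^]\<^bsub>R'\<^esub> (k::nat) \<otimes>\<^bsub>R'\<^esub> b = \<psi> a"
      using surj[OF b(1)] by blast
    have S: "r [^]\<^bsub>R\<^esub> m \<in> S" for m :: nat by (auto simp: S_def powers_of_def)
    have S': "\<psi> r [^]\<^bsub>R'\<^esub> m \<in> S'" for m :: nat by (auto simp: S'_def powers_of_def)
    \<comment> \<open>Since \<open>\<psi> a\<close> is the \<open>k\<close>-th power of
      \<open>\<psi> r\<close> times \<open>b\<close>, and \<open>s'\<close> is the
      \<open>n\<close>-th power, the denominator has to be the power \<open>k + n\<close>.\<close>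
    have "h (L.frac a (r [^]\<^bsub>R\<^esub> k \<otimes>\<^bsub>R\<^esub> r [^]\<^bsub>R\<^esub> n)) = Y"
      unfolding b(3)
    proof (subst h, simp_all add: S a, intro L'.frac_eqI)
      show "s' \<otimes>\<^bsub>R'\<^esub> \<psi> a = \<psi> (r [^]\<^bsub>R\<^esub> k) \<otimes>\<^bsub>R'\<^esub> \<psi> (r [^]\<^bsub>R\<^esub> n) \<otimes>\<^bsub>R'\<^esub> b"
        using b r unfolding n a(2)[symmetric]
        by (simp add: hom_pow R'.m_ac)
    qed (use a b S S' r hom_pow in simp_all)
    then show ?thesis using a S by (intro bexI) auto
  qed
  ultimately have "h \<in> ring_iso (localisation R S) (localisation R' S')"
    unfolding ring_iso_def bij_betw_def by (auto simp: ring_hom_closed)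
  moreover have "\<forall>a\<in>carrier R. h (to_localisation_at R r a) = to_localisation_at R' (\<psi> r) (\<psi> a)"
    by (simp add: to_localisation_at_def S_def[symmetric] S'_def[symmetric] h)
  ultimately show ?thesis
    unfolding localisation_at_def S_def S'_def by blast
qed

text \<open>\<open>g\<close> and \<open>h\<close> send \<open>s/1\<close> to the same element, which \<open>g (1/s)\<close> inverts, so it can be cancelled
  from the equation given by \<open>(s/1) (a/s) = a/1\<close>.\<close>

lemma localisation_at_hom_eq:
  assumes "cring R" "cring R'" and r: "r \<in> carrier R"
    and g: "g \<in> ring_hom (localisation_at R r) R'"
    and h: "h \<in> ring_hom (localisation_at R r) R'"
    and eq: "\<And>a. a \<in> carrier R \<Longrightarrow> g (to_localisation_at R r a) = h (to_localisation_at R r a)"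
    and y: "y \<in> carrier (localisation_at R r)"
  shows "g y = h y"
proof -
  define S where "S = powers_of R r"
  interpret R: cring R by fact
  interpret R': cring R' by fact
  interpret L: cring_localisation R S
    unfolding S_def by (rule R.cring_localisation_powers[OF r])
  let ?L = "localisation R S"
  note [simp] = L.S_in_carrier L.S_mult L.S_one
  have g: "g \<in> ring_hom ?L R'" and h: "h \<in> ring_hom ?L R'"
    using g h by (simp_all add: localisation_at_def S_def)
  have eq: "g (L.frac a \<one>\<^bsub>R\<^esub>) = h (L.frac a \<one>\<^bsub>R\<^esub>)" if "a \<in> carrier R" for a
    using eq[OF that] by (simp add: to_localisation_at_def S_def)
  obtain a s where a: "a \<in> carrier R" "s \<in> S" "y = L.frac a s"
    using y unfolding localisation_at_def S_def[symmetric] by (rule L.localisation_cases)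
  define x where "x = g (L.frac s \<one>\<^bsub>R\<^esub>)"
  define w where "w = g (L.frac \<one>\<^bsub>R\<^esub> s)"
  have "L.frac \<one>\<^bsub>R\<^esub> s \<otimes>\<^bsub>?L\<^esub> L.frac s \<one>\<^bsub>R\<^esub> = \<one>\<^bsub>?L\<^esub>"
    using a unfolding L.one_localisation by (simp add: L.frac_mult, intro L.frac_eqI) auto
  then have wx: "w \<otimes>\<^bsub>R'\<^esub> x = \<one>\<^bsub>R'\<^esub>"
    using a unfolding w_def x_def
    by (simp flip: ring_hom_mult[OF g] add: ring_hom_one[OF g])
  have ya: "L.frac s \<one>\<^bsub>R\<^esub> \<otimes>\<^bsub>?L\<^esub> y = L.frac a \<one>\<^bsub>R\<^esub>"
    using a by (simp add: L.frac_mult, intro L.frac_eqI) (auto simp: R.m_comm)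
  have cl: "g y \<in> carrier R'" "h y \<in> carrier R'" "x \<in> carrier R'" "w \<in> carrier R'"
    using a ring_hom_closed[OF g] ring_hom_closed[OF h] by (auto simp: x_def w_def)
  have "x \<otimes>\<^bsub>R'\<^esub> g y = x \<otimes>\<^bsub>R'\<^esub> h y"
    using a eq[of a] eq[of s] ring_hom_mult[OF g, of "L.frac s \<one>\<^bsub>R\<^esub>" y]
      ring_hom_mult[OF h, of "L.frac s \<one>\<^bsub>R\<^esub>" y] ya by (simp add: x_def)
  then have "(w \<otimes>\<^bsub>R'\<^esub> x) \<otimes>\<^bsub>R'\<^esub> g y = (w \<otimes>\<^bsub>R'\<^esub> x) \<otimes>\<^bsub>R'\<^esub> h y"
    using cl by (simp add: R'.m_assoc)
  then show ?thesis using cl by (simp add: wx)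
qed

section \<open>Traces of 2 by 2 matrices\<close>

lemmas matrix2_simps = trace_def det_2 sum_2 matrix_matrix_mult_def mat_def forall_2

text \<open>Cayley-Hamilton. The entrywise form lets scalars multiply in the ring itself.\<close>

lemma matrix2_square:
  fixes A :: "'a::comm_ring_1^2^2"
  shows "(A ** A)$i$j = trace A * A$i$j - det A * (mat 1 :: 'a^2^2)$i$j"
proof -
  have "\<forall>i j. (A ** A)$i$j = trace A * A$i$j - det A * (mat 1 :: 'a^2^2)$i$j"
    by (simp add: matrix2_simps algebra_simps)
  then show ?thesis by blast
qed

lemma matrix2_square_mult:
  fixes A B :: "'a::comm_ring_1^2^2"
  shows "(A ** (A ** B))$i$j = trace A * (A ** B)$i$j - det A * B$i$j"
proof -
  have "\<forall>i j. (A ** (A ** B))$i$j = trace A * (A ** B)$i$j - det A * B$i$j"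
    by (simp add: matrix2_simps algebra_simps)
  then show ?thesis by blast
qed

text \<open>Polarised Cayley-Hamilton: subtract the relations for \<open>A\<close> and
  \<open>B\<close> from the one for \<open>A + B\<close> and solve for
  \<open>B ** A\<close>.\<close>

lemma matrix2_swap:
  fixes A B :: "'a::comm_ring_1^2^2"
  shows "(B ** A)$i$j = (trace (A ** B) - trace A * trace B) * (mat 1 :: 'a^2^2)$i$j
    + trace B * A$i$j + trace A * B$i$j - (A ** B)$i$j"
proof -
  have "\<forall>i j. (B ** A)$i$j = (trace (A ** B) - trace A * trace B) * (mat 1 :: 'a^2^2)$i$j
    + trace B * A$i$j + trace A * B$i$j - (A ** B)$i$j"
    by (simp add: matrix2_simps algebra_simps)
  then show ?thesis by blast
qed

text \<open>Multiply \<open>AB + adj(AB) = tr(AB)\<close> by \<open>B\<close> on the left and use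
  \<open>adj(AB) = adj(B) adj(A)\<close>. The bracket is the adjugate of \<open>A\<close>.\<close>

lemma matrix2_sandwich:
  fixes A B :: "'a::comm_ring_1^2^2"
  shows "(B ** (A ** B))$i$j = trace (A ** B) * B$i$j
    - det B * (trace A * (mat 1 :: 'a^2^2)$i$j - A$i$j)"
proof -
  have "\<forall>i j. (B ** (A ** B))$i$j = trace (A ** B) * B$i$j
    - det B * (trace A * (mat 1 :: 'a^2^2)$i$j - A$i$j)"
    by (simp add: matrix2_simps algebra_simps)
  then show ?thesis by blast
qed

text \<open>Cramer's rule for the Gram matrix of the trace form on \<open>1, A, B, AB\<close>, whose determinant is
  \<open>- \<rho>\<^sup>2\<close>; one factor \<open>\<rho>\<close> cancels from the adjugate.\<close>

definition cramer_one :: "'a::comm_ring_1 \<Rightarrow> 'a \<Rightarrow> 'a \<Rightarrow> 'a \<Rightarrow> 'a \<Rightarrow> 'a \<Rightarrow> 'a \<Rightarrow> 'a" where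
  "cramer_one x1 x2 x12 t t1 t2 t12 =
     (x12^2 - x1*x2*x12 + x1^2 + x2^2 - 2) * t - x1 * t1 - x2 * t2 + (x1*x2 - x12) * t12"

definition cramer_A :: "'a::comm_ring_1 \<Rightarrow> 'a \<Rightarrow> 'a \<Rightarrow> 'a \<Rightarrow> 'a \<Rightarrow> 'a \<Rightarrow> 'a \<Rightarrow> 'a" where
  "cramer_A x1 x2 x12 t t1 t2 t12 = 2 * t1 - x1 * t + x12 * t2 - x2 * t12"

definition cramer_B :: "'a::comm_ring_1 \<Rightarrow> 'a \<Rightarrow> 'a \<Rightarrow> 'a \<Rightarrow> 'a \<Rightarrow> 'a \<Rightarrow> 'a \<Rightarrow> 'a" where
  "cramer_B x1 x2 x12 t t1 t2 t12 = x12 * t1 - x2 * t + 2 * t2 - x1 * t12"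

definition cramer_AB :: "'a::comm_ring_1 \<Rightarrow> 'a \<Rightarrow> 'a \<Rightarrow> 'a \<Rightarrow> 'a \<Rightarrow> 'a \<Rightarrow> 'a \<Rightarrow> 'a" where
  "cramer_AB x1 x2 x12 t t1 t2 t12 = (x1*x2 - x12) * t - x2 * t1 - x1 * t2 + 2 * t12"

lemmas cramer_defs = cramer_one_def cramer_A_def cramer_B_def cramer_AB_def

text \<open>At the traces of \<open>A\<close>, \<open>B\<close> and \<open>AB\<close> with
  determinants 1, this is the trace of the commutator of \<open>A\<close> and \<open>B\<close> minus
  2.\<close>

definition Fricke_rho :: "'a::comm_ring_1 \<Rightarrow> 'a \<Rightarrow> 'a \<Rightarrow> 'a" where
  "Fricke_rho x1 x2 x12 = x1^2 + x2^2 + x12^2 - x1*x2*x12 - 4"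

lemma rho_mult_matrix:
  fixes A B C :: "'a::comm_ring_1^2^2"
  assumes "det A = 1" "det B = 1"
  defines "x1 \<equiv> trace A" and "x2 \<equiv> trace B" and "x12 \<equiv> trace (A ** B)"
    and "t \<equiv> trace C" and "t1 \<equiv> trace (A ** C)" and "t2 \<equiv> trace (B ** C)"
    and "t12 \<equiv> trace (A ** (B ** C))"
  shows "Fricke_rho x1 x2 x12 * C$i$j =
    cramer_one x1 x2 x12 t t1 t2 t12 * (mat 1 :: 'a^2^2)$i$j + cramer_A x1 x2 x12 t t1 t2 t12 * A$i$j
    + cramer_B x1 x2 x12 t t1 t2 t12 * B$i$j + cramer_AB x1 x2 x12 t t1 t2 t12 * (A ** B)$i$j"
proof -
  \<comment> \<open>Inserting determinants makes the formula homogeneous in \<open>A\<close> and in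
    \<open>B\<close>. It is then a polynomial identity in the matrix entries, provable by expansion
    without assuming determinant 1.\<close>
  have homogeneous: "\<forall>i j.
    (x1^2 * det B + x2^2 * det A + x12^2 - x1*x2*x12 - 4 * det A * det B) * C$i$j =
    ((x12^2 - x1*x2*x12 + x1^2 * det B + x2^2 * det A - 2 * det A * det B) * t
       - x1 * det B * t1 - x2 * det A * t2 + (x1*x2 - x12) * t12) * (mat 1 :: 'a^2^2)$i$j
    + (2 * det B * t1 - x1 * det B * t + x12 * t2 - x2 * t12) * A$i$j
    + (x12 * t1 - x2 * det A * t + 2 * det A * t2 - x1 * t12) * B$i$j
    + ((x1*x2 - x12) * t - x2 * t1 - x1 * t2 + 2 * t12) * (A ** B)$i$j"
    unfolding x1_def x2_def x12_def t_def t1_def t2_def t12_def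
    by (simp add: matrix2_simps power2_eq_square algebra_simps)
  show ?thesis
    using homogeneous[rule_format, of i j] assms(1,2)
    by (simp add: Fricke_rho_def cramer_defs algebra_simps)
qed

text \<open>Multiply the expansion of \<open>\<rho> C\<close> in the basis \<open>1, A, B, AB\<close> by \<open>C\<close> and take traces.\<close>

lemma Fricke_phi_trace:
  fixes A B C :: "'a::{idom,ring_char_0}^2^2"
  assumes "det A = 1" "det B = 1"
  defines "x1 \<equiv> trace A" and "x2 \<equiv> trace B" and "x3 \<equiv> trace C" and "x12 \<equiv> trace (A ** B)"
    and "x13 \<equiv> trace (A ** C)" and "x23 \<equiv> trace (B ** C)" and "x123 \<equiv> trace (A ** (B ** C))"
  shows "Fricke_phi x1 x2 x3 x12 x13 x23 x123 = Fricke_rho x1 x2 x12 * (1 - det C)"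
proof -
  let ?r = "Fricke_rho x1 x2 x12"
  define c cA cB cAB where
    c: "c = cramer_one x1 x2 x12 x3 x13 x23 x123" "cA = cramer_A x1 x2 x12 x3 x13 x23 x123"
      "cB = cramer_B x1 x2 x12 x3 x13 x23 x123" "cAB = cramer_AB x1 x2 x12 x3 x13 x23 x123"
  have C: "?r * C$i$j = c * (mat 1 :: 'a^2^2)$i$j + cA * A$i$j + cB * B$i$j + cAB * (A ** B)$i$j" for i j
    unfolding c x1_def x2_def x3_def x12_def x13_def x23_def x123_def
    using assms(1,2) by (rule rho_mult_matrix)
  have "?r * trace (C ** C) = C$1$1 * (?r * C$1$1) + C$1$2 * (?r * C$2$1)
       + C$2$1 * (?r * C$1$2) + C$2$2 * (?r * C$2$2)"
    by (simp add: matrix2_simps algebra_simps)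
  also have "\<dots> = c * x3 + cA * x13 + cB * x23 + cAB * x123"
    unfolding C x3_def x13_def x23_def x123_def by (simp add: matrix2_simps algebra_simps)
  finally have *: "?r * trace (C ** C) = c * x3 + cA * x13 + cB * x23 + cAB * x123" .
  have "trace (C ** C) = x3^2 - 2 * det C"
    by (simp add: x3_def matrix2_simps power2_eq_square algebra_simps)
  \<comment> \<open>Inserting the value of \<open>trace (C ** C)\<close> gives twice the claim; the
    factor 2 cancels in characteristic zero.\<close>
  with * have "2 * Fricke_phi x1 x2 x3 x12 x13 x23 x123 = 2 * (?r * (1 - det C))"
    unfolding c by (simp add: Fricke_phi_def Fricke_rho_def cramer_defs power2_eq_square algebra_simps)
  then show ?thesis by simp
qed

section \<open>Matrices with prescribed traces\<close>

text \<open>The first matrix is a companion matrix. The off-diagonal entries \<open>q\<close> and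
  \<open>q - x12\<close> of the second give the product the diagonal entries \<open>x12 - q\<close>
  and \<open>q\<close>. Its determinant is 1 exactly if \<open>q\<close> is a root of
  \<open>q^2 - x12 q + 1\<close>.\<close>

lemma ex_SL2_pair_with_traces:
  fixes x1 x2 x12 :: complex
  obtains A B :: "complex^2^2" where
    "det A = 1" "det B = 1" "trace A = x1" "trace B = x2" "trace (A ** B) = x12"
proof -
  define q where "q = (x12 + csqrt (x12^2 - 4)) / 2"
  have q: "q * (x12 - q) = 1"
  proof -
    have "q * (x12 - q) = (x12^2 - (csqrt (x12^2 - 4))^2) / 4"
      by (simp add: q_def field_simps power2_eq_square)
    then show ?thesis by simp
  qed
  show ?thesis
  proof
    show "det (vector [vector [x1, -1], vector [1, 0]] :: complex^2^2) = 1"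
      "det (vector [vector [0, q], vector [q - x12, x2]] :: complex^2^2) = 1"
      "trace (vector [vector [x1, -1], vector [1, 0]] :: complex^2^2) = x1"
      "trace (vector [vector [0, q], vector [q - x12, x2]] :: complex^2^2) = x2"
      using q by (simp_all add: matrix2_simps algebra_simps)
    show "trace ((vector [vector [x1, -1], vector [1, 0]] :: complex^2^2)
        ** vector [vector [0, q], vector [q - x12, x2]]) = x12"
      by (simp add: matrix2_simps algebra_simps)
  qed
qed

lemma ex_matrix_with_traces:
  fixes A B :: "'a::field^2^2"
  assumes AB: "det A = 1" "det B = 1"
    and \<rho>: "Fricke_rho (trace A) (trace B) (trace (A ** B)) \<noteq> 0"
  obtains C :: "'a^2^2" where "trace C = t" "trace (A ** C) = t1" "trace (B ** C) = t2"
    "trace (A ** (B ** C)) = t12"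
proof -
  define x1 x2 x12 where x: "x1 = trace A" "x2 = trace B" "x12 = trace (A ** B)"
  let ?r = "Fricke_rho x1 x2 x12"
  let ?c = "cramer_one x1 x2 x12 t t1 t2 t12" and ?cA = "cramer_A x1 x2 x12 t t1 t2 t12"
    and ?cB = "cramer_B x1 x2 x12 t t1 t2 t12" and ?cAB = "cramer_AB x1 x2 x12 t t1 t2 t12"
  define C :: "'a^2^2" where
    "C = (\<chi> i j. (?c * (mat 1 :: 'a^2^2)$i$j + ?cA * A$i$j + ?cB * B$i$j + ?cAB * (A ** B)$i$j) / ?r)"
  \<comment> \<open>For \<open>M\<close> equal to 1, \<open>A\<close>, \<open>B\<close> and
    \<open>AB\<close> these are the four rows of the Gram system, which the Cramer coefficients
    solve.\<close>
  have trace_mult_C: "?r * trace (M ** C) = ?c * trace M + ?cA * trace (M ** A)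
      + ?cB * trace (M ** B) + ?cAB * trace (M ** (A ** B))" for M
  proof -
    have C: "?r * C$i$j = ?c * (mat 1 :: 'a^2^2)$i$j + ?cA * A$i$j + ?cB * B$i$j + ?cAB * (A ** B)$i$j" for i j
      using \<rho> by (simp add: C_def x)
    have "?r * trace (M ** C) = M$1$1 * (?r * C$1$1) + M$1$2 * (?r * C$2$1)
       + M$2$1 * (?r * C$1$2) + M$2$2 * (?r * C$2$2)"
      by (simp add: matrix2_simps algebra_simps)
    also have "\<dots> = ?c * trace M + ?cA * trace (M ** A)
      + ?cB * trace (M ** B) + ?cAB * trace (M ** (A ** B))"
      unfolding C by (simp add: matrix2_simps algebra_simps)
    finally show ?thesis .
  qed
  have square: "trace (M ** M) = trace M ^ 2 - 2 * det M" for M :: "'a^2^2"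
    by (simp add: matrix2_simps power2_eq_square algebra_simps)
  have "trace (A ** (A ** B)) = trace A * trace (A ** B) - det A * trace B"
    "trace (B ** (A ** B)) = trace B * trace (A ** B) - det B * trace A"
    by (simp_all add: matrix2_simps algebra_simps)
  then have sq: "trace (A ** A) = x1^2 - 2" "trace (B ** B) = x2^2 - 2" "trace (B ** A) = x12"
    "trace (A ** (A ** B)) = x1 * x12 - x2" "trace (B ** (A ** B)) = x2 * x12 - x1"
    "trace ((A ** B) ** A) = x1 * x12 - x2" "trace ((A ** B) ** B) = x2 * x12 - x1"
    "trace ((A ** B) ** (A ** B)) = x12^2 - 2"
    using AB by (simp_all add: square x det_mul trace_mul_sym[of "A ** B"] trace_mul_sym[of B A])
  have I: "trace (mat 1 :: 'a^2^2) = 2" by (simp add: matrix2_simps)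
  have "?r * trace C = ?r * t"
    using trace_mult_C[of "mat 1"] unfolding matrix_mul_lid I x[symmetric] Fricke_rho_def cramer_defs
    by (simp add: power2_eq_square algebra_simps)
  moreover have "?r * trace (A ** C) = ?r * t1"
    using trace_mult_C[of "A"] unfolding sq x[symmetric] Fricke_rho_def cramer_defs
    by (simp add: power2_eq_square algebra_simps)
  moreover have "?r * trace (B ** C) = ?r * t2"
    using trace_mult_C[of "B"] unfolding sq x[symmetric] Fricke_rho_def cramer_defs
    by (simp add: power2_eq_square algebra_simps)
  moreover have "?r * trace ((A ** B) ** C) = ?r * t12"
    using trace_mult_C[of "A ** B"] unfolding sq x[symmetric] Fricke_rho_def cramer_defs
    by (simp add: power2_eq_square algebra_simps)
  moreover have "?r \<noteq> 0" using \<rho> by (simp add: x)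
  ultimately show ?thesis
    by (intro that[of C]) (simp_all add: matrix_mul_assoc)
qed

section \<open>Relations between the small generators\<close>

text \<open>With \<open>phi_const\<close>, the lower coefficients of \<open>Fricke_phi\<close> as a
  monic quadratic in its last argument.\<close>

definition phi_linear :: "'a::comm_ring_1 \<Rightarrow> 'a \<Rightarrow> 'a \<Rightarrow> 'a \<Rightarrow> 'a \<Rightarrow> 'a \<Rightarrow> 'a" where
  "phi_linear x1 x2 x3 x12 x13 x23 = x1*x2*x3 - x1*x23 - x2*x13 - x3*x12"

definition phi_const :: "'a::comm_ring_1 \<Rightarrow> 'a \<Rightarrow> 'a \<Rightarrow> 'a \<Rightarrow> 'a \<Rightarrow> 'a \<Rightarrow> 'a" where
  "phi_const x1 x2 x3 x12 x13 x23 = x1^2 + x2^2 + x3^2 + x12^2 + x13^2 + x23^2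
     - x1*x2*x12 - x1*x3*x13 - x2*x3*x23 + x12*x13*x23 - 4"

lemma Fricke_phi_quadratic:
  "Fricke_phi x1 x2 x3 x12 x13 x23 x123 =
     x123^2 + phi_linear x1 x2 x3 x12 x13 x23 * x123 + phi_const x1 x2 x3 x12 x13 x23"
  by (simp add: Fricke_phi_def phi_linear_def phi_const_def)

lemma zpoly_eval_phi12:
  "zpoly_eval x (phi12 i) =
     Fricke_phi (x {1}) (x {2}) (x {i}) (x {1,2}) (x {1,i}) (x {2,i}) (x {1,2,i})"
  by (simp add: phi12_def Fricke_phi_def)

lemma zpoly_eval_rho: "zpoly_eval x rho = Fricke_rho (x {1}) (x {2}) (x {1,2})"
  by (simp add: rho_def Fricke_rho_def)

text \<open>Stated with \<open>Suc 0\<close>, the simplifier's normal form of 1.\<close>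

lemma small_index_mem:
  assumes "m \<ge> 2"
  shows "{Suc 0} \<in> small_index m" "{2} \<in> small_index m" "{Suc 0, 2} \<in> small_index m"
    "3 \<le> i \<Longrightarrow> i \<le> m \<Longrightarrow> {i} \<in> small_index m"
    "3 \<le> i \<Longrightarrow> i \<le> m \<Longrightarrow> {Suc 0, i} \<in> small_index m"
    "3 \<le> i \<Longrightarrow> i \<le> m \<Longrightarrow> {2, i} \<in> small_index m"
    "3 \<le> i \<Longrightarrow> i \<le> m \<Longrightarrow> {Suc 0, 2, i} \<in> small_index m"
proof -
  have single: "{i} \<in> small_index m" if "1 \<le> i" "i \<le> m" for i
    using that unfolding small_index_def by blast
  have pair: "{i, j} \<in> small_index m" if "1 \<le> i" "i \<le> 2" "i < j" "j \<le> m" for i j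
    using that unfolding small_index_def by blast
  have triple: "{1, 2, i} \<in> small_index m" if "3 \<le> i" "i \<le> m" for i
    using that unfolding small_index_def by blast
  show "{Suc 0} \<in> small_index m" "{2} \<in> small_index m" "{Suc 0, 2} \<in> small_index m"
    "3 \<le> i \<Longrightarrow> i \<le> m \<Longrightarrow> {i} \<in> small_index m"
    "3 \<le> i \<Longrightarrow> i \<le> m \<Longrightarrow> {Suc 0, i} \<in> small_index m"
    "3 \<le> i \<Longrightarrow> i \<le> m \<Longrightarrow> {2, i} \<in> small_index m"
    "3 \<le> i \<Longrightarrow> i \<le> m \<Longrightarrow> {Suc 0, 2, i} \<in> small_index m"
    using assms single[of 1] single[of 2] pair[of 1 2] single[of i] pair[of 1 i] pair[of 2 i] triple[of i]
    by simp_all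
qed

lemma small_index_subset: "small_index m \<subseteq> Fricke_index m"
  by (auto simp: small_index_def Fricke_index_def)

text \<open>These indeterminates stay free: each \<open>phi12 i\<close> is a monic quadratic in its
  own triple indeterminate with coefficients in them.\<close>

definition base_index :: "nat \<Rightarrow> nat set set" where
  "base_index m = small_index m - (\<lambda>i. {1, 2, i}) ` {3..m}"

lemma base_index_mem:
  assumes "m \<ge> 2"
  shows "{Suc 0} \<in> base_index m" "{2} \<in> base_index m" "{Suc 0, 2} \<in> base_index m"
    "3 \<le> i \<Longrightarrow> i \<le> m \<Longrightarrow> {i} \<in> base_index m"
    "3 \<le> i \<Longrightarrow> i \<le> m \<Longrightarrow> {Suc 0, i} \<in> base_index m"
    "3 \<le> i \<Longrightarrow> i \<le> m \<Longrightarrow> {2, i} \<in> base_index m"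
proof -
  have base: "X \<in> base_index m" if "X \<in> small_index m" "card X \<le> 2" for X
  proof -
    have "card {1, 2, i} = 3" if "3 \<le> i" for i :: nat using that by (simp add: card_insert_if)
    then show ?thesis using that by (fastforce simp: base_index_def)
  qed
  show "{Suc 0} \<in> base_index m" "{2} \<in> base_index m" "{Suc 0, 2} \<in> base_index m"
    "3 \<le> i \<Longrightarrow> i \<le> m \<Longrightarrow> {i} \<in> base_index m"
    "3 \<le> i \<Longrightarrow> i \<le> m \<Longrightarrow> {Suc 0, i} \<in> base_index m"
    "3 \<le> i \<Longrightarrow> i \<le> m \<Longrightarrow> {2, i} \<in> base_index m"
    by (rule base; simp add: small_index_mem assms card_insert_if)+
qed

lemma rho_in_polys: "m \<ge> 2 \<Longrightarrow> rho \<in> polys (base_index m)"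
  unfolding rho_def by (intro polys_intros) (simp_all add: base_index_mem)

lemma phi12_in_polys: "m \<ge> 2 \<Longrightarrow> 3 \<le> i \<Longrightarrow> i \<le> m \<Longrightarrow> phi12 i \<in> polys (small_index m)"
  unfolding phi12_def Fricke_phi_def by (intro polys_intros) (simp_all add: small_index_mem)

lemma monic_quadratic_roots:
  fixes p s :: complex
  assumes "p^2 - 4 * s \<noteq> 0"
  obtains u v where "u \<noteq> v" "u^2 + p * u + s = 0" "v^2 + p * v + s = 0"
proof
  define w where "w = csqrt (p^2 - 4 * s)"
  have w: "w^2 = p^2 - 4 * s" "w \<noteq> 0" using assms by (simp_all add: w_def)
  show "(w - p) / 2 \<noteq> (- w - p) / 2" using w by simp
  have "((w - p) / 2)^2 + p * ((w - p) / 2) + s = (w^2 - p^2) / 4 + s"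
    "((- w - p) / 2)^2 + p * ((- w - p) / 2) + s = (w^2 - p^2) / 4 + s"
    by (simp_all add: field_simps power2_eq_square)
  then show "((w - p) / 2)^2 + p * ((w - p) / 2) + s = 0"
    "((- w - p) / 2)^2 + p * ((- w - p) / 2) + s = 0"
    by (simp_all add: w)
qed

text \<open>Eliminating \<open>x\<^sub>1\<^sub>2\<^sub>j\<close> by division with remainder \<open>a + b x\<^sub>1\<^sub>2\<^sub>j\<close>: where the discriminant of
  \<open>\<phi>\<^sub>1\<^sub>2\<^sub>j\<close> is nonzero, both roots may be inserted, so \<open>a\<close> and \<open>b\<close> vanish there. The exceptional
  loci are collected in \<open>d\<close>. All discriminants are nonzero at the origin, which keeps their
  product nonzero.\<close>

lemma mem_phi_ideal_if_vanishing:
  assumes m: "m \<ge> 2" and "finite T" "T \<subseteq> {3..m}"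
    and "d \<in> polys (base_index m)" "zpoly_eval (\<lambda>_. 0 :: complex) d \<noteq> 0"
    and "f \<in> polys (small_index m)"
    and "\<And>x :: nat set \<Rightarrow> complex. zpoly_eval x d \<noteq> 0 \<Longrightarrow> (\<And>i. i \<in> T \<Longrightarrow> zpoly_eval x (phi12 i) = 0)
      \<Longrightarrow> zpoly_eval x f = 0"
  shows "f \<in> Idl\<^bsub>zpoly_ring (small_index m)\<^esub> (phi12 ` T)"
  using assms(2-)
proof (induction T arbitrary: d f rule: finite_induct)
  interpret R: cring "zpoly_ring (small_index m)" by (rule cring_zpoly_ring)
  case empty
  \<comment> \<open>With no relations left, \<open>f\<close> vanishes wherever \<open>d\<close> does
    not, hence identically.\<close>
  have "f = 0"
    by (rule zpoly_eq_0_if_vanishing_generically[OF empty(3)]) (use empty in auto)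
  moreover have "ideal (Idl\<^bsub>zpoly_ring (small_index m)\<^esub> {}) (zpoly_ring (small_index m))"
    by (rule R.genideal_ideal) simp
  then have "\<zero>\<^bsub>zpoly_ring (small_index m)\<^esub> \<in> Idl\<^bsub>zpoly_ring (small_index m)\<^esub> {}"
    by (intro additive_subgroup.zero_closed ideal.axioms)
  ultimately show ?case by simp
next
  interpret R: cring "zpoly_ring (small_index m)" by (rule cring_zpoly_ring)
  case (insert j T)
  have j: "3 \<le> j" "j \<le> m" using insert.prems by auto
  let ?z = "{Suc 0, 2, j}" and ?S = "small_index m"
  let ?I = "Idl\<^bsub>zpoly_ring ?S\<^esub> (phi12 ` insert j T)"
  define p s :: "nat set zpoly" where
    "p = phi_linear (Var {1}) (Var {2}) (Var {j}) (Var {1,2}) (Var {1,j}) (Var {2,j})" and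
    "s = phi_const (Var {1}) (Var {2}) (Var {j}) (Var {1,2}) (Var {1,j}) (Var {2,j})"
  have base: "base_index m \<subseteq> ?S - {?z}"
    using j by (auto simp: base_index_def)
  have ps_base: "p \<in> polys (base_index m)" "s \<in> polys (base_index m)"
    unfolding p_def s_def phi_linear_def phi_const_def
    using m j by (intro polys_intros; simp add: base_index_mem)+
  then have ps: "p \<in> polys (?S - {?z})" "s \<in> polys (?S - {?z})"
    using polys_mono[OF base] by auto
  have z: "?z \<in> ?S" using m j by (simp add: small_index_mem)
  have phi: "phi12 j = (Var ?z)^2 + p * Var ?z + s"
    by (simp add: phi12_def p_def s_def Fricke_phi_quadratic)
  obtain a b q where abq: "a \<in> polys (?S - {?z})" "b \<in> polys (?S - {?z})" "q \<in> polys ?S"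
    and f: "f = a + b * Var ?z + q * phi12 j"
    using polys_monic_quadratic_division[OF ps z insert.prems(4)] unfolding phi by metis
  \<comment> \<open>Zeros of the discriminant are excluded too; the induction hypothesis is used for
    \<open>a\<close> and \<open>b\<close> with this larger exceptional locus.\<close>
  define d' where "d' = d * (p^2 - 4 * s)"
  have d': "d' \<in> polys (base_index m)"
    using insert.prems(2) ps_base unfolding d'_def by (intro polys_intros)
  \<comment> \<open>At the origin \<open>p\<close> is 0 and \<open>s\<close> is -4, so the
    discriminant is 16.\<close>
  have d'0: "zpoly_eval (\<lambda>_. 0 :: complex) d' \<noteq> 0"
    using insert.prems(3) by (simp add: d'_def p_def s_def phi_linear_def phi_const_def)
  have vanish: "zpoly_eval x a = 0 \<and> zpoly_eval x b = 0"
    if x: "zpoly_eval x d' \<noteq> 0" "\<And>i. i \<in> T \<Longrightarrow> zpoly_eval x (phi12 i) = 0"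
    for x :: "nat set \<Rightarrow> complex"
  proof -
    have upd: "zpoly_eval (x(?z := w)) g = zpoly_eval x g" if "g \<in> polys (?S - {?z})" for g w
      using that by (rule zpoly_eval_cong) auto
    \<comment> \<open>Moving only the coordinate \<open>?z\<close> to a root \<open>w\<close>
      changes neither \<open>d\<close> nor the other relations and makes \<open>phi12 j\<close>
      vanish, so the hypothesis on \<open>f\<close> applies.\<close>
    have root: "zpoly_eval x a + zpoly_eval x b * w = 0"
      if w: "w^2 + zpoly_eval x p * w + zpoly_eval x s = 0" for w
    proof -
      have phij: "zpoly_eval (x(?z := w)) (phi12 j) = 0"
        unfolding phi using w ps by (simp add: upd)
      have "zpoly_eval (x(?z := w)) f = 0"
      proof (rule insert.prems(5))
        show "zpoly_eval (x(?z := w)) d \<noteq> 0"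
          using x(1) upd[of d] insert.prems(2) polys_mono[OF base] by (auto simp: d'_def)
        fix i assume i: "i \<in> insert j T"
        show "zpoly_eval (x(?z := w)) (phi12 i) = 0"
        proof (cases "i = j")
          case False
          have "i \<in> T" "3 \<le> i" using False i insert.prems(1) by auto
          have "i \<notin> ?z" using False \<open>3 \<le> i\<close> by simp
          then have triple: "{Suc 0, 2, i} \<noteq> ?z" by blast
          \<comment> \<open>Cardinality separates the triple from all indices with at most two
            elements.\<close>
          have "card ?z = 3" using j by (simp add: card_insert_if)
          then have ne: "X \<noteq> ?z" if "card X \<le> 2" for X using that by auto
          have pair: "(x(?z := w)) X = x X" if "card X \<le> 2" for X
            by (rule fun_upd_other[OF ne[OF that]])
          have "zpoly_eval (x(?z := w)) (phi12 i) = zpoly_eval x (phi12 i)"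
            unfolding zpoly_eval_phi12 One_nat_def fun_upd_other[OF triple]
            using \<open>3 \<le> i\<close> by (subst pair, simp add: card_insert_if)+ (rule refl)
          then show ?thesis using x(2)[OF \<open>i \<in> T\<close>] by simp
        qed (simp add: phij)
      qed
      then show ?thesis
        unfolding f using abq phij by (simp add: upd)
    qed
    have "zpoly_eval x p ^ 2 - 4 * zpoly_eval x s \<noteq> 0"
      using x(1) by (simp add: d'_def)
    then obtain u v where uv: "u \<noteq> v" "u^2 + zpoly_eval x p * u + zpoly_eval x s = 0"
      "v^2 + zpoly_eval x p * v + zpoly_eval x s = 0"
      by (rule monic_quadratic_roots)
    have "zpoly_eval x b * (u - v) =
        (zpoly_eval x a + zpoly_eval x b * u) - (zpoly_eval x a + zpoly_eval x b * v)"
      by (simp add: algebra_simps)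
    also have "\<dots> = 0" by (simp only: root uv) simp
    finally have "zpoly_eval x b * (u - v) = 0" .
    then show ?thesis using uv root[of u] by auto
  qed
  have gens: "phi12 ` insert j T \<subseteq> polys ?S"
    using insert.prems(1) m by (auto intro!: phi12_in_polys)
  interpret I: ideal ?I "zpoly_ring ?S"
    by (rule R.genideal_ideal) (use gens in simp)
  have sub: "Idl\<^bsub>zpoly_ring ?S\<^esub> (phi12 ` T) \<subseteq> ?I"
    by (rule R.subset_Idl_subset) (use gens in auto)
  have S_sub: "polys (?S - {?z}) \<subseteq> polys ?S" by (rule polys_mono) auto
  have T: "T \<subseteq> {3..m}" using insert.prems(1) by auto
  have "a \<in> ?I" "b \<in> ?I"
    using insert.IH[OF T d' d'0, of a] insert.IH[OF T d' d'0, of b] vanish abq S_sub sub by blast+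
  moreover have "phi12 j \<in> ?I"
    using R.genideal_self[of "phi12 ` insert j T"] gens by auto
  ultimately have "a \<oplus>\<^bsub>zpoly_ring ?S\<^esub> b \<otimes>\<^bsub>zpoly_ring ?S\<^esub> Var ?z
      \<oplus>\<^bsub>zpoly_ring ?S\<^esub> q \<otimes>\<^bsub>zpoly_ring ?S\<^esub> phi12 j \<in> ?I"
    using abq z by (intro I.a_closed I.I_l_closed I.I_r_closed) auto
  then show ?case unfolding f by simp
qed

section \<open>Points realised by tuples in SL(2)\<close>

lemma trace_word_sorted:
  assumes "sorted xs" "distinct xs"
  shows "trace_word A (set xs) = trace (foldr (\<lambda>i B. A i ** B) xs (mat 1))"
proof -
  have "sorted_list_of_set (set xs) = xs"
    using assms by (rule sorted_list_of_set.idem_if_sorted_distinct)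
  then show ?thesis by (simp add: trace_word_def)
qed

lemma trace_word_simps:
  "trace_word A {i} = trace (A i)"
  "i < j \<Longrightarrow> trace_word A {i, j} = trace (A i ** A j)"
  "i < j \<Longrightarrow> j < k \<Longrightarrow> trace_word A {i, j, k} = trace (A i ** (A j ** A k))"
  using trace_word_sorted[of "[i]" A] trace_word_sorted[of "[i, j]" A] trace_word_sorted[of "[i, j, k]" A]
  by simp_all

lemma PiE_SL2_det: "A \<in> {1..m} \<rightarrow>\<^sub>E SL2 \<Longrightarrow> 1 \<le> i \<Longrightarrow> i \<le> m \<Longrightarrow> det (A i) = 1"
  by (auto simp: SL2_def)

lemma Fricke_eval_rho:
  "Fricke_eval A rho = Fricke_rho (trace (A 1)) (trace (A 2)) (trace (A 1 ** A 2))"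
  by (simp add: Fricke_eval_def zpoly_eval_rho trace_word_simps)

lemma Fricke_eval_phi12:
  fixes A :: "nat \<Rightarrow> complex^2^2"
  assumes "A \<in> {1..m} \<rightarrow>\<^sub>E SL2" "3 \<le> i" "i \<le> m"
  shows "Fricke_eval A (phi12 i) = 0"
proof -
  have "det (A 1) = 1" "det (A 2) = 1" "det (A i) = 1"
    using assms by (auto intro!: PiE_SL2_det[OF assms(1)])
  then show ?thesis
    using assms(2) Fricke_phi_trace[of "A 1" "A 2" "A i"]
    by (simp add: Fricke_eval_def zpoly_eval_phi12 trace_word_simps)
qed

text \<open>A small trace involves at most one matrix beyond the first two. Once these two are fixed
  with \<open>rho\<close> nonzero, the others can be chosen independently of each other.\<close>

lemma ex_SL2_tuple_with_traces:
  fixes x :: "nat set \<Rightarrow> complex"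
  assumes "m \<ge> 2" and rho: "zpoly_eval x rho \<noteq> 0"
    and phi: "\<And>i. i \<in> {3..m} \<Longrightarrow> zpoly_eval x (phi12 i) = 0"
  obtains A :: "nat \<Rightarrow> complex^2^2" where "A \<in> {1..m} \<rightarrow>\<^sub>E SL2"
    "\<And>I. I \<in> small_index m \<Longrightarrow> trace_word A I = x I"
proof -
  obtain A1 A2 :: "complex^2^2" where A12: "det A1 = 1" "det A2 = 1"
    "trace A1 = x {1}" "trace A2 = x {2}" "trace (A1 ** A2) = x {1, 2}"
    by (rule ex_SL2_pair_with_traces)
  have r: "Fricke_rho (trace A1) (trace A2) (trace (A1 ** A2)) \<noteq> 0"
    using rho by (simp add: zpoly_eval_rho A12)
  have "\<exists>C. det C = 1 \<and> trace C = x {i} \<and> trace (A1 ** C) = x {1, i} \<and> trace (A2 ** C) = x {2, i} \<and>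
      trace (A1 ** (A2 ** C)) = x {1, 2, i}" if "i \<in> {3..m}" for i
  proof -
    obtain C :: "complex^2^2" where C: "trace C = x {i}" "trace (A1 ** C) = x {1, i}"
      "trace (A2 ** C) = x {2, i}" "trace (A1 ** (A2 ** C)) = x {1, 2, i}"
      using ex_matrix_with_traces[OF A12(1,2) r] by metis
    \<comment> \<open>As the first factor is nonzero, the relation forces
      \<open>det C = 1\<close>.\<close>
    have "Fricke_rho (trace A1) (trace A2) (trace (A1 ** A2)) * (1 - det C) = 0"
      using phi[OF that] Fricke_phi_trace[OF A12(1,2), of C] by (simp add: zpoly_eval_phi12 A12 C)
    then show ?thesis using r C by auto
  qed
  then obtain C where C: "\<And>i. i \<in> {3..m} \<Longrightarrow> det (C i) = 1 \<and> trace (C i) = x {i} \<and>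
      trace (A1 ** C i) = x {1, i} \<and> trace (A2 ** C i) = x {2, i} \<and>
      trace (A1 ** (A2 ** C i)) = x {1, 2, i}"
    by metis
  define A where "A = restrict (\<lambda>i. if i = 1 then A1 else if i = 2 then A2 else C i) {1..m}"
  have A: "A (Suc 0) = A1" "A 2 = A2" "3 \<le> i \<Longrightarrow> i \<le> m \<Longrightarrow> A i = C i" for i
    using assms(1) by (auto simp: A_def)
  show ?thesis
  proof
    show "A \<in> {1..m} \<rightarrow>\<^sub>E SL2"
      using A12(1,2) C by (auto simp: A_def SL2_def)
    fix I assume "I \<in> small_index m"
    then consider i where "I = {i}" "1 \<le> i" "i \<le> m"
      | i j where "I = {i, j}" "1 \<le> i" "i \<le> 2" "i < j" "j \<le> m"
      | k where "I = {1, 2, k}" "3 \<le> k" "k \<le> m"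
      unfolding small_index_def by blast
    then show "trace_word A I = x I"
    proof cases
      case 1
      then consider "i = 1" | "i = 2" | "3 \<le> i" by linarith
      then show ?thesis using 1 A12 C[of i] by cases (simp_all add: trace_word_simps A)
    next
      case 2
      then consider "i = 1" "j = 2" | "i = 1" "3 \<le> j" | "i = 2" "3 \<le> j" by linarith
      then show ?thesis using 2 A12 C[of j] by cases (simp_all add: trace_word_simps A)
    next
      case 3
      then show ?thesis using C[of k] by (simp add: trace_word_simps A)
    qed
  qed
qed

section \<open>The Fricke ideal and its restriction to the small generators\<close>

lemma polys_subset_Fricke: "polys (small_index m) \<subseteq> polys (Fricke_index m)"
  by (rule polys_mono[OF small_index_subset])

lemma mem_Fricke_ideal_iff:
  "f \<in> Fricke_ideal m \<longleftrightarrow> f \<in> polys (Fricke_index m) \<and>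
     (\<forall>A :: nat \<Rightarrow> complex^2^2. A \<in> {1..m} \<rightarrow>\<^sub>E SL2 \<longrightarrow> Fricke_eval A f = 0)"
  by (simp add: Fricke_ideal_def)

lemma ideal_Fricke_ideal: "ideal (Fricke_ideal m) (zpoly_ring (Fricke_index m))"
proof (rule idealI)
  interpret cring "zpoly_ring (Fricke_index m)" by (rule cring_zpoly_ring)
  show "ring (zpoly_ring (Fricke_index m))" by (rule ring_axioms)
  show "subgroup (Fricke_ideal m) (add_monoid (zpoly_ring (Fricke_index m)))"
  proof (rule add.subgroupI)
    show "Fricke_ideal m \<subseteq> carrier (zpoly_ring (Fricke_index m))"
      by (auto simp: mem_Fricke_ideal_iff)
    have "0 \<in> Fricke_ideal m" by (simp add: mem_Fricke_ideal_iff Fricke_eval_def)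
    then show "Fricke_ideal m \<noteq> {}" by blast
  qed (auto simp: mem_Fricke_ideal_iff Fricke_eval_def a_inv_zpoly_ring intro: polys_intros
         simp flip: a_inv_def)
qed (auto simp: mem_Fricke_ideal_iff Fricke_eval_def)

lemma cring_Fricke_ring: "cring (Fricke_ring m)"
  unfolding Fricke_ring_def
  by (rule ideal.quotient_is_cring[OF ideal_Fricke_ideal cring_zpoly_ring])

lemma Fricke_class_hom: "Fricke_class m \<in> ring_hom (zpoly_ring (Fricke_index m)) (Fricke_ring m)"
  using ideal.rcos_ring_hom[OF ideal_Fricke_ideal] unfolding Fricke_ring_def Fricke_class_def .

text \<open>The ideal is defined by vanishing at complex tuples, so identities in the quotient may
  be checked by evaluation there.\<close>

lemma Fricke_class_eq_iff:
  assumes "f \<in> polys (Fricke_index m)" "g \<in> polys (Fricke_index m)"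
  shows "Fricke_class m f = Fricke_class m g \<longleftrightarrow>
    (\<forall>A :: nat \<Rightarrow> complex^2^2. A \<in> {1..m} \<rightarrow>\<^sub>E SL2 \<longrightarrow> Fricke_eval A f = Fricke_eval A g)"
proof -
  interpret cring "zpoly_ring (Fricke_index m)" by (rule cring_zpoly_ring)
  have "Fricke_class m f = Fricke_class m g \<longleftrightarrow> f \<ominus>\<^bsub>zpoly_ring (Fricke_index m)\<^esub> g \<in> Fricke_ideal m"
    unfolding Fricke_class_def using assms
    by (intro quotient_eq_iff_same_a_r_cos[symmetric] ideal_Fricke_ideal) simp_all
  also have "f \<ominus>\<^bsub>zpoly_ring (Fricke_index m)\<^esub> g = f - g"
    using assms by (simp add: minus_eq a_inv_zpoly_ring)
  finally show ?thesis
    using assms by (auto simp: mem_Fricke_ideal_iff Fricke_eval_def)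
qed

lemma Fricke_class_zero: "\<zero>\<^bsub>Fricke_ring m\<^esub> = Fricke_class m 0"
proof -
  interpret ring_hom_cring "zpoly_ring (Fricke_index m)" "Fricke_ring m" "Fricke_class m"
    using Fricke_class_hom cring_zpoly_ring cring_Fricke_ring
    by (intro ring_hom_cringI ring_hom_ringI2) (auto dest: cring.axioms)
  show ?thesis using hom_zero by simp
qed

lemma small_Fricke_class_hom: "Fricke_class m \<in> ring_hom (zpoly_ring (small_index m)) (Fricke_ring m)"
proof (rule ring_hom_memI)
  note hom = Fricke_class_hom[of m]
  fix p q assume "p \<in> carrier (zpoly_ring (small_index m))" "q \<in> carrier (zpoly_ring (small_index m))"
  then have pq: "p \<in> polys (Fricke_index m)" "q \<in> polys (Fricke_index m)"
    using polys_subset_Fricke[of m] by auto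
  show "Fricke_class m p \<in> carrier (Fricke_ring m)"
    using ring_hom_closed[OF hom, of p] pq by simp
  show "Fricke_class m (p \<otimes>\<^bsub>zpoly_ring (small_index m)\<^esub> q) =
      Fricke_class m p \<otimes>\<^bsub>Fricke_ring m\<^esub> Fricke_class m q"
    using ring_hom_mult[OF hom, of p q] pq by simp
  show "Fricke_class m (p \<oplus>\<^bsub>zpoly_ring (small_index m)\<^esub> q) =
      Fricke_class m p \<oplus>\<^bsub>Fricke_ring m\<^esub> Fricke_class m q"
    using ring_hom_add[OF hom, of p q] pq by simp
next
  note hom = Fricke_class_hom[of m]
  show "Fricke_class m \<one>\<^bsub>zpoly_ring (small_index m)\<^esub> = \<one>\<^bsub>Fricke_ring m\<^esub>"
    using ring_hom_one[OF hom] by simp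
qed

text \<open>The relations hold on tuples by \<open>Fricke_phi_trace\<close>. Conversely, a kernel
  element vanishes at all solutions with \<open>rho\<close> nonzero, as they come from tuples, and
  elimination puts it into the ideal.\<close>

lemma kernel_small_Fricke_class:
  assumes "m \<ge> 2"
  shows "a_kernel (zpoly_ring (small_index m)) (Fricke_ring m) (Fricke_class m) = phi_ideal m"
proof
  let ?R = "zpoly_ring (small_index m)"
  interpret R: cring ?R by (rule cring_zpoly_ring)
  interpret F: cring "Fricke_ring m" by (rule cring_Fricke_ring)
  interpret h: ring_hom_cring ?R "Fricke_ring m" "Fricke_class m"
    using small_Fricke_class_hom by unfold_locales
  have kernel: "f \<in> a_kernel ?R (Fricke_ring m) (Fricke_class m) \<longleftrightarrow>
      f \<in> polys (small_index m) \<and>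
      (\<forall>A :: nat \<Rightarrow> complex^2^2. A \<in> {1..m} \<rightarrow>\<^sub>E SL2 \<longrightarrow> Fricke_eval A f = 0)" for f
  proof (cases "f \<in> polys (small_index m)")
    case True
    then have "f \<in> polys (Fricke_index m)" using polys_subset_Fricke by blast
    then have "Fricke_class m f = \<zero>\<^bsub>Fricke_ring m\<^esub> \<longleftrightarrow>
        (\<forall>A :: nat \<Rightarrow> complex^2^2. A \<in> {1..m} \<rightarrow>\<^sub>E SL2 \<longrightarrow> Fricke_eval A f = Fricke_eval A 0)"
      unfolding Fricke_class_zero by (intro Fricke_class_eq_iff polys_zero)
    with True show ?thesis
      by (simp only: a_kernel_def' mem_Collect_eq carrier_zpoly_ring Fricke_eval_def zpoly_eval_zero)
  qed (simp only: a_kernel_def' mem_Collect_eq carrier_zpoly_ring simp_thms)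
  show "phi_ideal m \<subseteq> a_kernel ?R (Fricke_ring m) (Fricke_class m)"
    unfolding phi_ideal_def
    by (intro R.genideal_minimal h.ring.kernel_is_ideal)
       (auto simp: kernel phi12_in_polys Fricke_eval_phi12 assms)
  show "a_kernel ?R (Fricke_ring m) (Fricke_class m) \<subseteq> phi_ideal m"
  proof
    fix f assume "f \<in> a_kernel ?R (Fricke_ring m) (Fricke_class m)"
    then have f: "f \<in> polys (small_index m)"
      "\<And>A :: nat \<Rightarrow> complex^2^2. A \<in> {1..m} \<rightarrow>\<^sub>E SL2 \<Longrightarrow> Fricke_eval A f = 0"
      by (auto simp: kernel)
    have rho0: "zpoly_eval (\<lambda>_. 0 :: complex) rho \<noteq> 0"
      by (simp add: rho_def)
    show "f \<in> phi_ideal m"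
      unfolding phi_ideal_def
    \<comment> \<open>The elimination starts with \<open>d = rho\<close>, whose value at the origin
      is -4.\<close>
    proof (rule mem_phi_ideal_if_vanishing[OF assms _ _ rho_in_polys[OF assms] rho0 f(1)])
      fix x :: "nat set \<Rightarrow> complex"
      assume "zpoly_eval x rho \<noteq> 0" "\<And>i. i \<in> {3..m} \<Longrightarrow> zpoly_eval x (phi12 i) = 0"
      then obtain A :: "nat \<Rightarrow> complex^2^2" where A: "A \<in> {1..m} \<rightarrow>\<^sub>E SL2"
        "\<And>I. I \<in> small_index m \<Longrightarrow> trace_word A I = x I"
        using ex_SL2_tuple_with_traces[OF assms] by metis
      have "zpoly_eval x f = Fricke_eval A f"
        unfolding Fricke_eval_def using f(1) A(2) by (metis zpoly_eval_cong)
      then show "zpoly_eval x f = 0" using f(2)[OF A(1)] by simp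
    qed auto
  qed
qed

section \<open>Generation by the small generators\<close>

text \<open>Up to a power of \<open>\<rho>\<close>, \<open>W\<close> is a combination of \<open>1, A\<^sub>1, A\<^sub>2, A\<^sub>1A\<^sub>2\<close> with coefficients in
  \<open>\<int>[x\<^sub>I | I \<in> \<I>\<^sub>m]\<close>.\<close>

definition rho_combination :: "nat \<Rightarrow> nat \<Rightarrow> nat set zpoly \<Rightarrow> nat set zpoly \<Rightarrow> nat set zpoly
    \<Rightarrow> nat set zpoly \<Rightarrow> ((nat \<Rightarrow> complex^2^2) \<Rightarrow> complex^2^2) \<Rightarrow> bool" where
  "rho_combination m n a b c d W \<longleftrightarrow> a \<in> polys (small_index m) \<and> b \<in> polys (small_index m) \<and>
     c \<in> polys (small_index m) \<and> d \<in> polys (small_index m) \<and>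
     (\<forall>A \<in> {1..m} \<rightarrow>\<^sub>E SL2. \<forall>i j. Fricke_eval A rho ^ n * W A $ i $ j =
       Fricke_eval A a * (mat 1 :: complex^2^2)$i$j + Fricke_eval A b * A 1 $ i $ j
       + Fricke_eval A c * A 2 $ i $ j + Fricke_eval A d * (A 1 ** A 2) $ i $ j)"

definition rho_spanned :: "nat \<Rightarrow> ((nat \<Rightarrow> complex^2^2) \<Rightarrow> complex^2^2) \<Rightarrow> bool" where
  "rho_spanned m W \<longleftrightarrow> (\<exists>n a b c d. rho_combination m n a b c d W)"

lemma rho_combinationD:
  assumes "rho_combination m n a b c d W"
  shows "a \<in> polys (small_index m)" "b \<in> polys (small_index m)"
    "c \<in> polys (small_index m)" "d \<in> polys (small_index m)"
    "A \<in> {1..m} \<rightarrow>\<^sub>E SL2 \<Longrightarrow> Fricke_eval A rho ^ n * W A $ i $ j =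
       Fricke_eval A a * (mat 1 :: complex^2^2)$i$j + Fricke_eval A b * A 1 $ i $ j
       + Fricke_eval A c * A 2 $ i $ j + Fricke_eval A d * (A 1 ** A 2) $ i $ j"
  using assms unfolding rho_combination_def by simp_all

lemma rho_spannedI:
  assumes "a \<in> polys (small_index m)" "b \<in> polys (small_index m)"
    "c \<in> polys (small_index m)" "d \<in> polys (small_index m)"
    "\<And>A i j. A \<in> {1..m} \<rightarrow>\<^sub>E SL2 \<Longrightarrow> Fricke_eval A rho ^ n * W A $ i $ j =
       Fricke_eval A a * (mat 1 :: complex^2^2)$i$j + Fricke_eval A b * A 1 $ i $ j
       + Fricke_eval A c * A 2 $ i $ j + Fricke_eval A d * (A 1 ** A 2) $ i $ j"
  shows "rho_spanned m W"
  unfolding rho_spanned_def rho_combination_def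
  by (intro exI[of _ n] exI[of _ a] exI[of _ b] exI[of _ c] exI[of _ d] conjI ballI allI assms)

lemma Fricke_eval_simps [simp]:
  "Fricke_eval A (p + q) = Fricke_eval A p + Fricke_eval A q"
  "Fricke_eval A (p - q) = Fricke_eval A p - Fricke_eval A q"
  "Fricke_eval A (- p) = - Fricke_eval A p"
  "Fricke_eval A (p * q) = Fricke_eval A p * Fricke_eval A q"
  "Fricke_eval A (p ^ n) = Fricke_eval A p ^ n"
  "Fricke_eval A (Var I) = trace_word A I"
  "Fricke_eval A 0 = 0" "Fricke_eval A 1 = 1" "Fricke_eval A (of_int k) = of_int k"
  "Fricke_eval A (numeral w) = numeral w"
  by (simp_all add: Fricke_eval_def)

lemma rho_in_small_polys: "m \<ge> 2 \<Longrightarrow> rho \<in> polys (small_index m)"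
  unfolding rho_def by (intro polys_intros) (simp_all add: small_index_mem)

lemma rho_spanned_one: "rho_spanned m (\<lambda>A. mat 1)"
  by (rule rho_spannedI[of 1 _ 0 0 0 0]) auto

lemma rho_spanned_scale:
  assumes "rho_spanned m W" "p \<in> polys (small_index m)"
    and V: "\<And>A i j. A \<in> {1..m} \<rightarrow>\<^sub>E SL2 \<Longrightarrow> V A $ i $ j = Fricke_eval A p * W A $ i $ j"
  shows "rho_spanned m V"
proof -
  obtain n a b c d where C: "rho_combination m n a b c d W"
    using assms(1) unfolding rho_spanned_def by blast
  note P = rho_combinationD(1-4)[OF C] and W = rho_combinationD(5)[OF C]
  show ?thesis
  proof (rule rho_spannedI[of "p * a" _ "p * b" "p * c" "p * d" n])
    fix A :: "nat \<Rightarrow> complex^2^2" and i j assume A: "A \<in> {1..m} \<rightarrow>\<^sub>E SL2"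
    have "Fricke_eval A rho ^ n * V A $ i $ j = Fricke_eval A p * (Fricke_eval A rho ^ n * W A $ i $ j)"
      by (simp add: V[OF A])
    then show "Fricke_eval A rho ^ n * V A $ i $ j =
       Fricke_eval A (p * a) * (mat 1 :: complex^2^2)$i$j + Fricke_eval A (p * b) * A 1 $ i $ j
       + Fricke_eval A (p * c) * A 2 $ i $ j + Fricke_eval A (p * d) * (A 1 ** A 2) $ i $ j"
      unfolding W[OF A] by (simp add: algebra_simps)
  qed (intro polys_intros P assms)+
qed

lemma rho_spanned_add:
  assumes "m \<ge> 2" "rho_spanned m W" "rho_spanned m W'"
    and V: "\<And>A i j. A \<in> {1..m} \<rightarrow>\<^sub>E SL2 \<Longrightarrow> V A $ i $ j = W A $ i $ j + W' A $ i $ j"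
  shows "rho_spanned m V"
proof -
  obtain n a b c d where C: "rho_combination m n a b c d W"
    using assms(2) unfolding rho_spanned_def by blast
  note P = rho_combinationD(1-4)[OF C] and W = rho_combinationD(5)[OF C]
  obtain n' a' b' c' d' where C': "rho_combination m n' a' b' c' d' W'"
    using assms(3) unfolding rho_spanned_def by blast
  note P' = rho_combinationD(1-4)[OF C'] and W' = rho_combinationD(5)[OF C']
  let ?f = "\<lambda>a a'. rho ^ n' * a + rho ^ n * a'"
  show ?thesis
  proof (rule rho_spannedI[of "?f a a'" _ "?f b b'" "?f c c'" "?f d d'" "n + n'"])
    fix A :: "nat \<Rightarrow> complex^2^2" and i j assume A: "A \<in> {1..m} \<rightarrow>\<^sub>E SL2"
    let ?r = "Fricke_eval A rho"
    have "?r ^ (n + n') * V A $ i $ j =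
        ?r ^ n' * (?r ^ n * W A $ i $ j) + ?r ^ n * (?r ^ n' * W' A $ i $ j)"
      by (simp add: V[OF A] power_add algebra_simps)
    then show "?r ^ (n + n') * V A $ i $ j =
       Fricke_eval A (?f a a') * (mat 1 :: complex^2^2)$i$j + Fricke_eval A (?f b b') * A 1 $ i $ j
       + Fricke_eval A (?f c c') * A 2 $ i $ j + Fricke_eval A (?f d d') * (A 1 ** A 2) $ i $ j"
      unfolding W[OF A] W'[OF A] by (simp add: algebra_simps)
  qed (intro polys_intros P P' rho_in_small_polys assms)+
qed

text \<open>The factor is absorbed into the exponent of \<open>rho\<close>.\<close>

lemma rho_spanned_cancel:
  assumes "rho_spanned m W"
    and V: "\<And>A i j. A \<in> {1..m} \<rightarrow>\<^sub>E SL2 \<Longrightarrow> W A $ i $ j = Fricke_eval A rho * V A $ i $ j"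
  shows "rho_spanned m V"
proof -
  obtain n a b c d where C: "rho_combination m n a b c d W"
    using assms(1) unfolding rho_spanned_def by blast
  note P = rho_combinationD(1-4)[OF C] and W = rho_combinationD(5)[OF C]
  show ?thesis
  proof (rule rho_spannedI[of a _ b c d "Suc n"])
    fix A :: "nat \<Rightarrow> complex^2^2" and i j assume A: "A \<in> {1..m} \<rightarrow>\<^sub>E SL2"
    have "Fricke_eval A rho ^ Suc n * V A $ i $ j = Fricke_eval A rho ^ n * W A $ i $ j"
      by (simp add: V[OF A])
    also note W[OF A]
    finally show "Fricke_eval A rho ^ Suc n * V A $ i $ j =
       Fricke_eval A a * (mat 1 :: complex^2^2)$i$j + Fricke_eval A b * A 1 $ i $ j
       + Fricke_eval A c * A 2 $ i $ j + Fricke_eval A d * (A 1 ** A 2) $ i $ j" .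
  qed (rule P)+
qed

lemma matrix2_mult_entry:
  fixes A B :: "'a::comm_ring_1^2^2"
  shows "(A ** B)$i$j = A$i$1 * B$1$j + A$i$2 * B$2$j"
  by (simp add: matrix_matrix_mult_def sum_2)

lemma matrix2_mult_combination:
  fixes M X A B C D :: "'a::comm_ring_1^2^2"
  assumes "\<And>i j. r * X$i$j = a * A$i$j + b * B$i$j + c * C$i$j + d * D$i$j"
  shows "r * (M ** X)$i$j = a * (M ** A)$i$j + b * (M ** B)$i$j + c * (M ** C)$i$j + d * (M ** D)$i$j"
proof -
  have "r * (M ** X)$i$j = M$i$1 * (r * X$1$j) + M$i$2 * (r * X$2$j)"
    by (simp add: matrix2_mult_entry algebra_simps)
  then show ?thesis unfolding assms by (simp add: matrix2_mult_entry algebra_simps)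
qed

text \<open>Left multiplication by \<open>A 1\<close> sends 1 and \<open>A 2\<close> to basis
  elements; Cayley-Hamilton reduces the images of the other two.\<close>

lemma rho_spanned_mult_first:
  assumes "m \<ge> 2" "rho_spanned m W"
  shows "rho_spanned m (\<lambda>A. A 1 ** W A)"
proof -
  obtain n a b c d where C: "rho_combination m n a b c d W"
    using assms(2) unfolding rho_spanned_def by blast
  note P = rho_combinationD(1-4)[OF C] and W = rho_combinationD(5)[OF C]
  have x1: "Var {1} \<in> polys (small_index m)"
    by (intro polys_Var) (simp add: small_index_mem assms)
  show ?thesis
  proof (rule rho_spannedI[of "- b" _ "a + b * Var {1}" "- d" "c + d * Var {1}" n])
    fix A :: "nat \<Rightarrow> complex^2^2" and i j assume A: "A \<in> {1..m} \<rightarrow>\<^sub>E SL2"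
    have det: "det (A 1) = 1" using PiE_SL2_det[OF A, of 1] assms(1) by simp
    show "Fricke_eval A rho ^ n * (A 1 ** W A) $ i $ j =
       Fricke_eval A (- b) * (mat 1 :: complex^2^2)$i$j + Fricke_eval A (a + b * Var {1}) * A 1 $ i $ j
       + Fricke_eval A (- d) * A 2 $ i $ j + Fricke_eval A (c + d * Var {1}) * (A 1 ** A 2) $ i $ j"
      unfolding matrix2_mult_combination[OF W[OF A]] matrix2_square matrix2_square_mult det
        matrix_mul_rid
      by (simp add: trace_word_simps algebra_simps)
  qed (intro polys_intros P x1)+
qed

text \<open>The products of \<open>A 2\<close> with \<open>A 1\<close>, \<open>A 2\<close> and
  \<open>A 1 ** A 2\<close> reduce by the swap rule, Cayley-Hamilton and the sandwich rule.\<close>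

lemma rho_spanned_mult_second:
  assumes "m \<ge> 2" "rho_spanned m W"
  shows "rho_spanned m (\<lambda>A. A 2 ** W A)"
proof -
  obtain n a b c d where C: "rho_combination m n a b c d W"
    using assms(2) unfolding rho_spanned_def by blast
  note P = rho_combinationD(1-4)[OF C] and W = rho_combinationD(5)[OF C]
  have x: "Var {1} \<in> polys (small_index m)" "Var {2} \<in> polys (small_index m)"
    "Var {1, 2} \<in> polys (small_index m)"
    by (intro polys_Var; simp add: small_index_mem assms)+
  let ?a = "b * (Var {1, 2} - Var {1} * Var {2}) - c - d * Var {1}" and ?b = "b * Var {2} + d"
    and ?c = "a + b * Var {1} + c * Var {2} + d * Var {1, 2}"
  show ?thesis
  proof (rule rho_spannedI[of ?a _ ?b ?c "- b" n])
    fix A :: "nat \<Rightarrow> complex^2^2" and i j assume A: "A \<in> {1..m} \<rightarrow>\<^sub>E SL2"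
    have det: "det (A 2) = 1" using PiE_SL2_det[OF A, of 2] assms(1) by simp
    show "Fricke_eval A rho ^ n * (A 2 ** W A) $ i $ j =
       Fricke_eval A ?a * (mat 1 :: complex^2^2)$i$j + Fricke_eval A ?b * A 1 $ i $ j
       + Fricke_eval A ?c * A 2 $ i $ j + Fricke_eval A (- b) * (A 1 ** A 2) $ i $ j"
      unfolding matrix2_mult_combination[OF W[OF A]] matrix2_square matrix2_sandwich
        matrix2_swap[where A = "A 1" and B = "A 2"] det matrix_mul_rid
      by (simp add: trace_word_simps algebra_simps)
  qed (intro polys_intros P x)+
qed

text \<open>For \<open>i\<close> at least 3, expanding \<open>rho\<close> times \<open>A i\<close>
  writes \<open>rho\<close> times \<open>A i ** W A\<close> as a combination of \<open>W A\<close>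
  and its products with \<open>A 1\<close>, \<open>A 2\<close> and \<open>A 1 ** A 2\<close>, all
  spanned already. Then \<open>rho\<close> is cancelled.\<close>

lemma rho_spanned_mult:
  assumes "m \<ge> 2" "rho_spanned m W" "1 \<le> i" "i \<le> m"
  shows "rho_spanned m (\<lambda>A. A i ** W A)"
proof -
  consider "i = 1" | "i = 2" | "3 \<le> i" using assms(3) by linarith
  then show ?thesis
  proof cases
    case 3
    \<comment> \<open>\<open>k\<close> inserts the generators belonging to \<open>i\<close> into a
      Cramer coefficient, making it a polynomial.\<close>
    define k where "k f = f (Var {1}) (Var {2}) (Var {1,2}) (Var {i}) (Var {1,i}) (Var {2,i}) (Var {1,2,i})"
      for f :: "nat set zpoly \<Rightarrow> nat set zpoly \<Rightarrow> nat set zpoly \<Rightarrow> nat set zpoly \<Rightarrow> nat set zpoly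
        \<Rightarrow> nat set zpoly \<Rightarrow> nat set zpoly \<Rightarrow> nat set zpoly"
    have k: "k cramer_one \<in> polys (small_index m)" "k cramer_A \<in> polys (small_index m)"
      "k cramer_B \<in> polys (small_index m)" "k cramer_AB \<in> polys (small_index m)"
      unfolding k_def cramer_defs using 3 assms
      by (intro polys_intros; simp add: small_index_mem)+
    let ?s = "\<lambda>p W A. (\<chi> i j. Fricke_eval A p * W A $ i $ j) :: complex^2^2"
    note W1 = rho_spanned_mult_first[OF assms(1,2)] and W2 = rho_spanned_mult_second[OF assms(1,2)]
    note W12 = rho_spanned_mult_first[OF assms(1) W2]
    have V: "rho_spanned m (?s (k cramer_one) W)" "rho_spanned m (?s (k cramer_A) (\<lambda>A. A 1 ** W A))"
      "rho_spanned m (?s (k cramer_B) (\<lambda>A. A 2 ** W A))"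
      "rho_spanned m (?s (k cramer_AB) (\<lambda>A. A 1 ** (A 2 ** W A)))"
      by (rule rho_spanned_scale[OF assms(2) k(1)] rho_spanned_scale[OF W1 k(2)]
          rho_spanned_scale[OF W2 k(3)] rho_spanned_scale[OF W12 k(4)], simp)+
    have "rho_spanned m (\<lambda>A. ?s (k cramer_one) W A + ?s (k cramer_A) (\<lambda>A. A 1 ** W A) A)"
      by (rule rho_spanned_add[OF assms(1) V(1,2)]) simp
    moreover have "rho_spanned m (\<lambda>A. ?s (k cramer_B) (\<lambda>A. A 2 ** W A) A
        + ?s (k cramer_AB) (\<lambda>A. A 1 ** (A 2 ** W A)) A)"
      by (rule rho_spanned_add[OF assms(1) V(3,4)]) simp
    ultimately have sum: "rho_spanned m (\<lambda>A. (?s (k cramer_one) W A + ?s (k cramer_A) (\<lambda>A. A 1 ** W A) A)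
      + (?s (k cramer_B) (\<lambda>A. A 2 ** W A) A + ?s (k cramer_AB) (\<lambda>A. A 1 ** (A 2 ** W A)) A))"
      by (rule rho_spanned_add[OF assms(1)]) simp
    show ?thesis
    proof (rule rho_spanned_cancel[OF sum])
      fix A :: "nat \<Rightarrow> complex^2^2" and p q assume A: "A \<in> {1..m} \<rightarrow>\<^sub>E SL2"
      have det: "det (A 1) = 1" "det (A 2) = 1"
        using PiE_SL2_det[OF A, of 1] PiE_SL2_det[OF A, of 2] assms(1) by simp_all
      have Ai: "Fricke_eval A rho * A i $ p $ q =
          Fricke_eval A (k cramer_one) * (mat 1 :: complex^2^2) $ p $ q
          + Fricke_eval A (k cramer_A) * A 1 $ p $ q + Fricke_eval A (k cramer_B) * A 2 $ p $ q
          + Fricke_eval A (k cramer_AB) * (A 1 ** A 2) $ p $ q" for p q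
        using rho_mult_matrix[OF det, of "A i" p q] 3
        by (simp add: Fricke_eval_rho k_def cramer_defs trace_word_simps)
      have "Fricke_eval A rho * (A i ** W A) $ p $ q =
          (Fricke_eval A rho * A i $ p $ 1) * W A $ 1 $ q + (Fricke_eval A rho * A i $ p $ 2) * W A $ 2 $ q"
        by (simp add: matrix2_mult_entry algebra_simps)
      also have "\<dots> = Fricke_eval A (k cramer_one) * (mat 1 ** W A) $ p $ q
          + Fricke_eval A (k cramer_A) * (A 1 ** W A) $ p $ q
          + Fricke_eval A (k cramer_B) * (A 2 ** W A) $ p $ q
          + Fricke_eval A (k cramer_AB) * ((A 1 ** A 2) ** W A) $ p $ q"
        unfolding Ai matrix2_mult_entry[of _ "W A"] by (simp add: algebra_simps)
      finally show "((?s (k cramer_one) W A + ?s (k cramer_A) (\<lambda>A. A 1 ** W A) A)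
        + (?s (k cramer_B) (\<lambda>A. A 2 ** W A) A + ?s (k cramer_AB) (\<lambda>A. A 1 ** (A 2 ** W A)) A)) $ p $ q =
        Fricke_eval A rho * (A i ** W A) $ p $ q"
        by (simp add: matrix_mul_assoc)
    qed
  next
    case 1
    then show ?thesis using rho_spanned_mult_first[OF assms(1,2)] by simp
  next
    case 2
    then show ?thesis using rho_spanned_mult_second[OF assms(1,2)] by simp
  qed
qed

lemma rho_spanned_word:
  assumes "m \<ge> 2" "set xs \<subseteq> {1..m}"
  shows "rho_spanned m (\<lambda>A. foldr (\<lambda>i B. A i ** B) xs (mat 1))"
  using assms(2) by (induction xs) (auto intro: rho_spanned_one rho_spanned_mult assms(1))

text \<open>The four basis matrices have traces 2 and the generators with indices 1, 2 and
  12.\<close>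

lemma rho_spanned_trace:
  assumes "m \<ge> 2" "rho_spanned m W"
  shows "\<exists>n. \<exists>g\<in>polys (small_index m). \<forall>A :: nat \<Rightarrow> complex^2^2. A \<in> {1..m} \<rightarrow>\<^sub>E SL2 \<longrightarrow>
    Fricke_eval A rho ^ n * trace (W A) = Fricke_eval A g"
proof -
  obtain n a b c d where C: "rho_combination m n a b c d W"
    using assms(2) unfolding rho_spanned_def by blast
  note P = rho_combinationD(1-4)[OF C] and W = rho_combinationD(5)[OF C]
  have x: "Var {1} \<in> polys (small_index m)" "Var {2} \<in> polys (small_index m)"
    "Var {1, 2} \<in> polys (small_index m)"
    by (intro polys_Var; simp add: small_index_mem assms)+
  show ?thesis
  proof (intro exI bexI allI impI)
    show "2 * a + b * Var {1} + c * Var {2} + d * Var {1, 2} \<in> polys (small_index m)"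
      by (intro polys_intros P x)
    fix A :: "nat \<Rightarrow> complex^2^2" assume A: "A \<in> {1..m} \<rightarrow>\<^sub>E SL2"
    have "Fricke_eval A rho ^ n * trace (W A) =
        Fricke_eval A rho ^ n * W A $ 1 $ 1 + Fricke_eval A rho ^ n * W A $ 2 $ 2"
      by (simp add: trace_def sum_2 algebra_simps)
    also have "\<dots> = Fricke_eval A (2 * a + b * Var {1} + c * Var {2} + d * Var {1, 2})"
      unfolding W[OF A] by (simp add: trace_word_simps trace_def sum_2 mat_def algebra_simps)
    finally show "Fricke_eval A rho ^ n * trace (W A) =
        Fricke_eval A (2 * a + b * Var {1} + c * Var {2} + d * Var {1, 2})" .
  qed
qed

text \<open>An indeterminate is the trace of a word, which is spanned; sums are brought to a common
  power of \<open>rho\<close> and products add the exponents.\<close>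

lemma ex_rho_power_mult_small:
  assumes m: "m \<ge> 2" and f: "f \<in> polys (Fricke_index m)"
  shows "\<exists>n. \<exists>g\<in>polys (small_index m). \<forall>A :: nat \<Rightarrow> complex^2^2. A \<in> {1..m} \<rightarrow>\<^sub>E SL2 \<longrightarrow>
    Fricke_eval A rho ^ n * Fricke_eval A f = Fricke_eval A g"
  using f
proof (induction rule: polys_induct)
  case (const c)
  show ?case by (intro exI[of _ 0] bexI[of _ "of_int c"]) auto
next
  case (var I)
  then have "rho_spanned m (\<lambda>A. foldr (\<lambda>i B. A i ** B) (sorted_list_of_set I) (mat 1))"
    using finite_subset[of I "{1..m}"] by (intro rho_spanned_word m) (simp add: Fricke_index_def)
  then show ?case
    unfolding Fricke_eval_simps trace_word_def by (rule rho_spanned_trace[OF m])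
next
  case (add f f')
  then obtain n g n' g' where g: "g \<in> polys (small_index m)" "g' \<in> polys (small_index m)"
    "\<And>A :: nat \<Rightarrow> complex^2^2. A \<in> {1..m} \<rightarrow>\<^sub>E SL2 \<Longrightarrow> Fricke_eval A rho ^ n * Fricke_eval A f = Fricke_eval A g"
    "\<And>A :: nat \<Rightarrow> complex^2^2. A \<in> {1..m} \<rightarrow>\<^sub>E SL2 \<Longrightarrow> Fricke_eval A rho ^ n' * Fricke_eval A f' = Fricke_eval A g'"
    by blast
  show ?case
    by (intro exI[of _ "n + n'"] bexI[of _ "rho ^ n' * g + rho ^ n * g'"])
      (auto simp: g(3,4)[symmetric] power_add algebra_simps intro!: polys_intros g rho_in_small_polys m)
next
  case (mult f f')
  then obtain n g n' g' where g: "g \<in> polys (small_index m)" "g' \<in> polys (small_index m)"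
    "\<And>A :: nat \<Rightarrow> complex^2^2. A \<in> {1..m} \<rightarrow>\<^sub>E SL2 \<Longrightarrow> Fricke_eval A rho ^ n * Fricke_eval A f = Fricke_eval A g"
    "\<And>A :: nat \<Rightarrow> complex^2^2. A \<in> {1..m} \<rightarrow>\<^sub>E SL2 \<Longrightarrow> Fricke_eval A rho ^ n' * Fricke_eval A f' = Fricke_eval A g'"
    by blast
  show ?case
    by (intro exI[of _ "n + n'"] bexI[of _ "g * g'"])
      (auto simp: g(3,4)[symmetric] power_add algebra_simps intro!: polys_intros g)
qed

section \<open>The isomorphism\<close>

lemma cring_phi_quotient:
  assumes "m \<ge> 2"
  shows "cring (phi_quotient m)" "phi_class m \<in> ring_hom (zpoly_ring (small_index m)) (phi_quotient m)"
proof -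
  interpret R: cring "zpoly_ring (small_index m)" by (rule cring_zpoly_ring)
  have "ideal (phi_ideal m) (zpoly_ring (small_index m))"
    unfolding phi_ideal_def by (rule R.genideal_ideal) (auto intro!: phi12_in_polys assms)
  then show "cring (phi_quotient m)" "phi_class m \<in> ring_hom (zpoly_ring (small_index m)) (phi_quotient m)"
    unfolding phi_quotient_def phi_class_def
    by (auto intro: ideal.quotient_is_cring cring_zpoly_ring ideal.rcos_ring_hom)
qed

lemma phi_quotient_cases:
  assumes "X \<in> carrier (phi_quotient m)"
  obtains f where "f \<in> polys (small_index m)" "X = phi_class m f"
  using assms unfolding phi_quotient_def phi_class_def FactRing_def A_RCOSETS_def' by auto

text \<open>The first isomorphism theorem for the kernel computed above.\<close>

lemma ex_phi_quotient_hom: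
  assumes "m \<ge> 2"
  obtains \<psi> where "\<psi> \<in> ring_hom (phi_quotient m) (Fricke_ring m)"
    "inj_on \<psi> (carrier (phi_quotient m))"
    "\<And>f. f \<in> polys (small_index m) \<Longrightarrow> \<psi> (phi_class m f) = Fricke_class m f"
proof -
  let ?R = "zpoly_ring (small_index m)" and ?h = "Fricke_class m"
  interpret R: cring ?R by (rule cring_zpoly_ring)
  interpret F: cring "Fricke_ring m" by (rule cring_Fricke_ring)
  interpret h: ring_hom_cring ?R "Fricke_ring m" ?h
    using small_Fricke_class_hom by unfold_locales
  note K = kernel_small_Fricke_class[OF assms]
  show ?thesis
  proof
    \<comment> \<open>The homomorphism is constant on cosets of its kernel, and
      \<open>the_elem\<close> extracts that value.\<close>
    show "(\<lambda>X. the_elem (?h ` X)) \<in> ring_hom (phi_quotient m) (Fricke_ring m)"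
      using h.ring.the_elem_hom unfolding K phi_quotient_def .
    show "inj_on (\<lambda>X. the_elem (?h ` X)) (carrier (phi_quotient m))"
      unfolding phi_quotient_def by (rule inj_onI) (rule h.ring.the_elem_inj[unfolded K])
    show "the_elem (?h ` phi_class m f) = ?h f" if "f \<in> polys (small_index m)" for f
      using h.ring.the_elem_simp[of f] that unfolding K phi_class_def by simp
  qed
qed

text \<open>The clause on \<open>g\<close> expresses that \<open>h\<close> is the homomorphism
  defined by its values on the generators: no other one has these values.\<close>

theorem corollary2p8:
  fixes m :: nat
  assumes "m \<ge> 2"
  shows "\<exists>h \<in> ring_iso (Phi' m) (Phi_rho m).
           (\<forall>I \<in> small_index m. h (x_Phi' m I) = x_Phi_rho m I) \<and>
           (\<forall>g \<in> ring_hom (Phi' m) (Phi_rho m).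
              (\<forall>I \<in> small_index m. g (x_Phi' m I) = x_Phi_rho m I) \<longrightarrow>
              (\<forall>y \<in> carrier (Phi' m). g y = h y))"
proof -
  let ?Q = "phi_quotient m" and ?F = "Fricke_ring m" and ?S = "small_index m"
  obtain \<psi> where \<psi>: "\<psi> \<in> ring_hom ?Q ?F" "inj_on \<psi> (carrier ?Q)"
    and \<psi>_class: "\<And>f. f \<in> polys ?S \<Longrightarrow> \<psi> (phi_class m f) = Fricke_class m f"
    using ex_phi_quotient_hom[OF assms] by metis
  note Q = cring_phi_quotient[OF assms]
  have rho: "rho \<in> polys ?S" using assms by (rule rho_in_small_polys)
  have class_closed: "phi_class m f \<in> carrier ?Q" if "f \<in> polys ?S" for f
    using ring_hom_closed[OF Q(2)] that by simp
  interpret F: cring ?F by (rule cring_Fricke_ring)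
  interpret P: cring "zpoly_ring (Fricke_index m)" by (rule cring_zpoly_ring)
  interpret c: ring_hom_cring "zpoly_ring (Fricke_index m)" ?F "Fricke_class m"
    using Fricke_class_hom by unfold_locales
  have rhoF: "rho \<in> polys (Fricke_index m)" using rho polys_subset_Fricke by blast
  have class_power: "Fricke_class m rho [^]\<^bsub>?F\<^esub> n \<otimes>\<^bsub>?F\<^esub> Fricke_class m f = Fricke_class m (rho ^ n * f)"
    if "f \<in> polys (Fricke_index m)" for n :: nat and f
  proof -
    have "Fricke_class m rho [^]\<^bsub>?F\<^esub> n = Fricke_class m (rho ^ n)"
    proof (induction n)
      case 0
      show ?case using c.hom_one by simp
    next
      case (Suc n)
      then show ?case
        using c.hom_mult[of "rho ^ n" rho] rhoF by (simp add: polys_power mult.commute)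
    qed
    then show ?thesis using c.hom_mult[of "rho ^ n" f] rhoF that by (simp add: polys_power)
  qed
  have "\<exists>h\<in>ring_iso (localisation_at ?Q (phi_class m rho)) (localisation_at ?F (\<psi> (phi_class m rho))).
    \<forall>a\<in>carrier ?Q. h (to_localisation_at ?Q (phi_class m rho) a) =
      to_localisation_at ?F (\<psi> (phi_class m rho)) (\<psi> a)"
  \<comment> \<open>What remains is surjectivity up to powers of \<open>rho\<close>, which comes
    from the expansion of words.\<close>
  proof (rule localisation_at_iso[OF Q(1) cring_Fricke_ring class_closed[OF rho] \<psi>])
    fix X assume "X \<in> carrier ?F"
    then obtain f where f: "f \<in> polys (Fricke_index m)" "X = Fricke_class m f"
      unfolding Fricke_ring_def Fricke_class_def FactRing_def A_RCOSETS_def' by auto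
    obtain n g where g: "g \<in> polys ?S" "\<And>A :: nat \<Rightarrow> complex^2^2. A \<in> {1..m} \<rightarrow>\<^sub>E SL2 \<Longrightarrow>
        Fricke_eval A rho ^ n * Fricke_eval A f = Fricke_eval A g"
      using ex_rho_power_mult_small[OF assms f(1)] by blast
    have "Fricke_class m (rho ^ n * f) = Fricke_class m g"
      using g f(1) rhoF polys_subset_Fricke[of m]
      by (subst Fricke_class_eq_iff) (auto intro!: polys_mult polys_power)
    then have "\<psi> (phi_class m rho) [^]\<^bsub>?F\<^esub> n \<otimes>\<^bsub>?F\<^esub> X = \<psi> (phi_class m g)"
      using g(1) f rho by (simp add: \<psi>_class class_power)
    then show "\<exists>n::nat. \<exists>a\<in>carrier ?Q. \<psi> (phi_class m rho) [^]\<^bsub>?F\<^esub> n \<otimes>\<^bsub>?F\<^esub> X = \<psi> a"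
      using class_closed[OF g(1)] by blast
  qed
  then obtain h where h: "h \<in> ring_iso (Phi' m) (Phi_rho m)"
    "\<And>f. f \<in> polys ?S \<Longrightarrow> h (to_localisation_at ?Q (phi_class m rho) (phi_class m f)) =
      to_localisation_at ?F (Fricke_class m rho) (Fricke_class m f)"
    unfolding Phi'_def Phi_rho_def using \<psi>_class rho class_closed by metis
  have x: "h (x_Phi' m I) = x_Phi_rho m I" if "I \<in> ?S" for I
    unfolding x_Phi'_def x_Phi_rho_def using that by (intro h(2)) auto
  \<comment> \<open>Composed with the map from the polynomial ring, \<open>g\<close> and
    \<open>h\<close> agree on indeterminates, hence on the image of the quotient, and this
    determines them on the localisation.\<close>
  have "g y = h y" if g: "g \<in> ring_hom (Phi' m) (Phi_rho m)"
    "\<forall>I \<in> ?S. g (x_Phi' m I) = x_Phi_rho m I" and y: "y \<in> carrier (Phi' m)" for g y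
  proof -
    interpret QS: cring_localisation ?Q "powers_of ?Q (phi_class m rho)"
      by (rule cring.cring_localisation_powers[OF Q(1) class_closed[OF rho]])
    interpret FS: cring_localisation ?F "powers_of ?F (Fricke_class m rho)"
      by (rule F.cring_localisation_powers) (use c.hom_closed rhoF in simp)
    have cring: "cring (Phi_rho m)"
      unfolding Phi_rho_def localisation_at_def by (rule FS.cring_localisation)
    have h_hom: "h \<in> ring_hom (Phi' m) (Phi_rho m)"
      using h(1) by (simp add: ring_iso_def)
    let ?t = "to_localisation_at ?Q (phi_class m rho)"
    have "?t \<in> ring_hom ?Q (Phi' m)"
      using QS.frac_one_ring_hom
      unfolding Phi'_def localisation_at_def to_localisation_at_def[abs_def] .
    then have t: "?t \<circ> phi_class m \<in> ring_hom (zpoly_ring ?S) (Phi' m)"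
      using Q(2) by (rule ring_hom_trans[rotated])
    have eq: "(g \<circ> (?t \<circ> phi_class m)) f = (h \<circ> (?t \<circ> phi_class m)) f" if "f \<in> polys ?S" for f
      using cring ring_hom_trans[OF t g(1)] ring_hom_trans[OF t h_hom] _ that
      by (rule zpoly_ring_hom_eq) (use g(2) x in \<open>simp add: x_Phi'_def\<close>)
    have "g (?t a) = h (?t a)" if a: "a \<in> carrier ?Q" for a
    proof -
      obtain f where "f \<in> polys ?S" "a = phi_class m f"
        using a by (rule phi_quotient_cases)
      then show ?thesis using eq[of f] by simp
    qed
    then show ?thesis
      by (rule localisation_at_hom_eq[OF Q(1) cring class_closed[OF rho]
            g(1)[unfolded Phi'_def] h_hom[unfolded Phi'_def] _ y[unfolded Phi'_def]])
  qed
  with x show ?thesis by (intro bexI[OF _ h(1)] conjI ballI impI) simp_all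
qed

end
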